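(* Let $T>0$, $L>0$, $\Omega=(0,L)$, $Q=(0,T)\times\Omega$ and $\gamma\in\mathbb{R}$. Let $x_0>L$ be such that $(x_0-L)^2<\frac13 x_0^2$, let $t_0\in(0,T)$, let $\beta>0$, and put $$\psi(t,x)=(x-x_0)^2-\beta(t-t_0)^2 .$$ For $\delta>0$ write $Q_\delta=\{(t,x)\in Q:\ \psi(t,x)>\delta\}$. Let $\varepsilon>0$ satisfy $(x_0-L)^2<\varepsilon<x_0^2$, and let $c\in(0,\varepsilon)$. Then there exist constants $\lambda_0>0$ and $C>0$ such that for every $\lambda>\lambda_0$ and every $v\in H^{(1,4)}(Q_c)$ with $\operatorname{supp} v\subset Q_\varepsilon$, $$\int_{Q_c}e^{2\lambda\psi}\Big(\lambda^7|v|^2+\lambda^5|\partial_x v|^2+\lambda^3|\partial_x^2 v|^2+\lambda|\partial_x^3 v|^2\Big)\,dx\,dt\ \le\ C\int_{Q_c}e^{2\lambda\psi}\,|\gamma\,\partial_t v+\partial_x^4 v|^2\,dx\,dt .$$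
   Context: $H^{(1,4)}(Q_c)$ denotes the space of functions $v\in L^2(Q_c)$ (real- or complex-valued) whose weak derivatives $\partial_t v$ and $\partial_x^j v$, $1\le j\le 4$, belong to $L^2(Q_c)$. $\operatorname{supp} v$ is the closed support of $v$ (closure taken in $\mathbb{R}^2$); the condition $\operatorname{supp} v\subset Q_\varepsilon$ thus means that $\operatorname{supp} v$ is a compact subset of the open set $Q_\varepsilon$, so that $v$ vanishes near the whole boundary of $Q_c$. The constants $\lambda_0$ and $C$ do not depend on $v$ or $\lambda$. *)

theory Defs
  imports "HOL-Analysis.Analysis"
begin

text \<open>Points of the plane are pairs \<open>(t, x)\<close>: time first, space second.\<close>

definition pdt :: "(real \<times> real \<Rightarrow> real) \<Rightarrow> real \<times> real \<Rightarrow> real" where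
  "pdt f = (\<lambda>(t, x). deriv (\<lambda>s. f (s, x)) t)"

definition pdx :: "(real \<times> real \<Rightarrow> real) \<Rightarrow> real \<times> real \<Rightarrow> real" where
  "pdx f = (\<lambda>(t, x). deriv (\<lambda>y. f (t, y)) x)"

primrec Ck :: "nat \<Rightarrow> (real \<times> real \<Rightarrow> real) \<Rightarrow> bool" where
  "Ck 0 f \<longleftrightarrow> continuous_on UNIV f"
| "Ck (Suc k) f \<longleftrightarrow> (\<forall>z. f differentiable (at z)) \<and> Ck k (pdt f) \<and> Ck k (pdx f)"

definition test_functions :: "(real \<times> real) set \<Rightarrow> (real \<times> real \<Rightarrow> real) set" where
  "test_functions U =
     {\<phi>. (\<forall>k. Ck k \<phi>) \<and> compact (closure {z. \<phi> z \<noteq> 0}) \<and> closure {z. \<phi> z \<noteq> 0} \<subseteq> U}"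

definition locally_integrable :: "(real \<times> real) set \<Rightarrow> (real \<times> real \<Rightarrow> complex) \<Rightarrow> bool" where
  "locally_integrable U f \<longleftrightarrow> (\<forall>K. compact K \<and> K \<subseteq> U \<longrightarrow> set_integrable lebesgue K f)"

text \<open>
  \<open>has_weak_pd U i j v g\<close>: on the open set \<open>U\<close>, \<open>g\<close> is a weak derivative of \<open>v\<close> of order \<open>i\<close>
  in \<open>t\<close> and \<open>j\<close> in \<open>x\<close>. Elements of \<open>L\<^sup>2(U)\<close> are represented by functions on the whole
  plane; in all notions below only their values on \<open>U\<close> matter.
\<close>

definition has_weak_pd ::
  "(real \<times> real) set \<Rightarrow> nat \<Rightarrow> nat \<Rightarrow> (real \<times> real \<Rightarrow> complex) \<Rightarrow> (real \<times> real \<Rightarrow> complex) \<Rightarrow> bool"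
  where
  "has_weak_pd U i j v g \<longleftrightarrow>
     locally_integrable U v \<and> locally_integrable U g \<and>
     (\<forall>\<phi> \<in> test_functions U.
        (LINT z:U|lebesgue. (pdt ^^ i) ((pdx ^^ j) \<phi>) z *\<^sub>R v z) =
        (-1) ^ (i + j) * (LINT z:U|lebesgue. \<phi> z *\<^sub>R g z))"

text \<open>
  Weak derivatives are unique only up to null sets, so \<open>weak_pd\<close> selects one representative.
\<close>

definition weak_pd ::
  "(real \<times> real) set \<Rightarrow> nat \<Rightarrow> nat \<Rightarrow> (real \<times> real \<Rightarrow> complex) \<Rightarrow> real \<times> real \<Rightarrow> complex" where
  "weak_pd U i j v = (SOME g. has_weak_pd U i j v g)"

definition L2 :: "(real \<times> real) set \<Rightarrow> (real \<times> real \<Rightarrow> complex) set" where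
  "L2 U = {f. set_borel_measurable lebesgue U f \<and> set_integrable lebesgue U (\<lambda>z. (cmod (f z))\<^sup>2)}"

definition weak_pd_in_L2 ::
  "(real \<times> real) set \<Rightarrow> nat \<Rightarrow> nat \<Rightarrow> (real \<times> real \<Rightarrow> complex) \<Rightarrow> bool" where
  "weak_pd_in_L2 U i j v \<longleftrightarrow> (\<exists>g. has_weak_pd U i j v g) \<and> weak_pd U i j v \<in> L2 U"

definition H14 :: "(real \<times> real) set \<Rightarrow> (real \<times> real \<Rightarrow> complex) set" where
  "H14 U = {v \<in> L2 U. weak_pd_in_L2 U 1 0 v \<and> (\<forall>j \<in> {1..4}. weak_pd_in_L2 U 0 j v)}"

text \<open>
  The closed support, in the plane, of an almost-everywhere class of functions on \<open>U\<close>: the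
  complement of the largest open set on which \<open>v\<close> vanishes almost everywhere. It may meet the
  boundary of \<open>U\<close>. It does not depend on the representative, and it is the smallest of
  the sets \<open>closure {z \<in> U. w z \<noteq> 0}\<close> over all representatives \<open>w\<close> of \<open>v\<close>.
\<close>

definition supp :: "(real \<times> real) set \<Rightarrow> (real \<times> real \<Rightarrow> complex) \<Rightarrow> (real \<times> real) set" where
  "supp U v = - \<Union> {W. open W \<and> (AE z in lebesgue. z \<in> W \<inter> U \<longrightarrow> v z = 0)}"

lemma closed_supp: "closed (supp U v)"
  unfolding supp_def by (intro closed_Compl open_Union) auto

lemma supp_subset_closure: "supp U v \<subseteq> closure {z \<in> U. v z \<noteq> 0}"
proof -
  have "AE z in lebesgue. z \<in> - closure {z \<in> U. v z \<noteq> 0} \<inter> U \<longrightarrow> v z = 0"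
    using closure_subset[of "{z \<in> U. v z \<noteq> 0}"] by (intro always_eventually) auto
  moreover have "open (- closure {z \<in> U. v z \<noteq> 0})"
    by auto
  ultimately show ?thesis
    unfolding supp_def by blast
qed

definition \<psi> :: "real \<Rightarrow> real \<Rightarrow> real \<Rightarrow> real \<times> real \<Rightarrow> real" where
  "\<psi> x0 t0 \<beta> = (\<lambda>(t, x). (x - x0)\<^sup>2 - \<beta> * (t - t0)\<^sup>2)"

definition Q :: "real \<Rightarrow> real \<Rightarrow> (real \<times> real) set" where
  "Q T L = {0<..<T} \<times> {0<..<L}"

definition Qsub :: "real \<Rightarrow> real \<Rightarrow> real \<Rightarrow> real \<Rightarrow> real \<Rightarrow> real \<Rightarrow> (real \<times> real) set" where
  "Qsub T L x0 t0 \<beta> \<delta> = {z \<in> Q T L. \<psi> x0 t0 \<beta> z > \<delta>}"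

end

theory Submission
  imports Defs
begin

text \<open>
  In \<open>L\<^sup>2\<close> with weight \<open>e\<^bsup>2\<lambda>\<psi>\<^esup>\<close>, the adjoint of \<open>\<partial>\<^sub>x\<close> is \<open>-B\<close> with \<open>B = \<partial>\<^sub>x + 4\<lambda>(x - x\<^sub>0)\<close>. Since \<open>\<psi>\<close> is
  quadratic in \<open>x\<close>, the commutator of \<open>\<partial>\<^sub>x\<close> and \<open>B\<close> is the constant \<open>4\<lambda>\<close>, so the two behave like creation
  and annihilation operators. Putting \<open>B\<^sup>4 \<partial>\<^sub>x\<^sup>4\<close> into normal order gives, for smooth compactly supported \<open>v\<close>
  and \<open>P = \<gamma> \<partial>\<^sub>t + \<partial>\<^sub>x\<^sup>4\<close> with adjoint \<open>P\<^sup>*\<close>, the identity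
  \<open>\<parallel>P v\<parallel>\<^sup>2 = \<parallel>P\<^sup>* v\<parallel>\<^sup>2 + 64\<lambda> \<parallel>B\<^sup>3 v\<parallel>\<^sup>2 + 1152\<lambda>\<^sup>2 \<parallel>B\<^sup>2 v\<parallel>\<^sup>2 + 6144\<lambda>\<^sup>3 \<parallel>B v\<parallel>\<^sup>2 + (6144\<lambda>\<^sup>4 - 4\<lambda>\<beta>\<gamma>\<^sup>2) \<parallel>v\<parallel>\<^sup>2\<close>;
  there are no cross terms of \<open>\<partial>\<^sub>t\<close> and \<open>\<partial>\<^sub>x\<close> because \<open>\<psi>\<close> is the sum of a function of \<open>t\<close> and a function
  of \<open>x\<close>. As \<open>x\<^sub>0 - x\<close> is bounded away from \<open>0\<close>, one has \<open>\<lambda>\<^sup>2 \<parallel>v\<parallel>\<^sup>2 \<le> C \<parallel>B v\<parallel>\<^sup>2\<close> for large \<open>\<lambda>\<close>, and hence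
  \<open>\<lambda> \<parallel>B\<^sup>3 v\<parallel>\<^sup>2\<close> dominates the left-hand side of the estimate. In general, the real and imaginary parts of
  \<open>v\<close> are mollified: \<open>P\<close> has constant coefficients, so on compact subsets mollification commutes with \<open>P\<close>
  in the weak sense, and both sides of the estimate pass to the limit.
\<close>

subsection \<open>Smooth bump functions\<close>

text \<open>The polynomial \<open>p\<close> and the exponent \<open>n\<close> make the family closed
  under differentiation. The choice \<open>p = 1\<close>, \<open>n = 0\<close> is the standard bump
  function on the interval of radius \<open>\<delta>\<close>.\<close>

definition bump_fun :: "real \<Rightarrow> real poly \<Rightarrow> nat \<Rightarrow> real \<Rightarrow> real" where
  "bump_fun \<delta> p n t =
     (if \<bar>t\<bar> < \<delta> then poly p t * inverse (\<delta>\<^sup>2 - t\<^sup>2) ^ n * exp (- inverse (\<delta>\<^sup>2 - t\<^sup>2)) else 0)"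

text \<open>The single term \<open>y ^ m / fact m\<close> of the exponential series is at most
  \<open>exp y\<close>.\<close>

lemma power_mult_exp_minus_le:
  fixes y :: real
  assumes "y \<ge> 0"
  shows "y ^ m * exp (- y) \<le> fact m"
proof -
  have "y ^ m / fact m \<le> (\<Sum>k. y ^ k / fact k)"
    using sum_le_suminf[of "\<lambda>k. y ^ k / fact k" "{m}"] summable_exp_generic[of y] assms
    by (simp add: field_simps)
  also have "\<dots> = exp y"
    by (simp add: exp_def field_simps)
  finally show ?thesis
    by (simp add: exp_minus field_simps)
qed

text \<open>With \<open>s = \<delta>\<^sup>2 - t\<^sup>2\<close>, the exponential beats
  \<open>n + 2\<close> powers of \<open>inverse s\<close>, two more than the function contains, so a
  factor \<open>s\<^sup>2\<close> is left over. This decay at the endpoints makes the extension by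
  zero differentiable there.\<close>

lemma bump_fun_le_square:
  assumes "\<delta> > 0"
  obtains C where "\<And>t. \<bar>bump_fun \<delta> p n t\<bar> \<le> C * (\<delta>\<^sup>2 - t\<^sup>2)\<^sup>2"
proof -
  have "bounded (poly p ` cbox (-\<delta>) \<delta>)"
    by (intro compact_imp_bounded compact_continuous_image continuous_intros compact_cbox)
  then obtain M where M: "\<And>t. t \<in> cbox (-\<delta>) \<delta> \<Longrightarrow> \<bar>poly p t\<bar> \<le> M"
    unfolding bounded_iff by (metis imageI real_norm_def)
  have "\<bar>bump_fun \<delta> p n t\<bar> \<le> M * fact (n + 2) * (\<delta>\<^sup>2 - t\<^sup>2)\<^sup>2" for t
  proof (cases "\<bar>t\<bar> < \<delta>")
    case True
    define s where "s = \<delta>\<^sup>2 - t\<^sup>2"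
    have s: "s > 0"
      using True abs_square_less_1 power_strict_mono[of "\<bar>t\<bar>" \<delta> 2] by (simp add: s_def)
    have "inverse s ^ (n + 2) * exp (- inverse s) \<le> fact (n + 2)"
      using s by (intro power_mult_exp_minus_le) auto
    then have "inverse s ^ (n + 2) * exp (- inverse s) * s\<^sup>2 \<le> fact (n + 2) * s\<^sup>2"
      by (intro mult_right_mono) auto
    then have le: "inverse s ^ n * exp (- inverse s) \<le> fact (n + 2) * s\<^sup>2"
      using s by (simp add: power_add field_simps power2_eq_square)
    have "\<bar>bump_fun \<delta> p n t\<bar> = \<bar>poly p t\<bar> * (inverse s ^ n * exp (- inverse s))"
      using True s by (simp add: bump_fun_def s_def abs_mult)
    also have "\<dots> \<le> M * (fact (n + 2) * s\<^sup>2)"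
      using M[of t] True s abs_ge_zero[of "poly p t"] by (intro mult_mono[OF _ le]) (auto simp: abs_less_iff)
    finally show ?thesis
      by (simp add: s_def)
  next
    case False
    have "M \<ge> 0"
      using M[of 0] assms by auto
    then show ?thesis
      using False by (simp add: bump_fun_def)
  qed
  then show ?thesis
    using that by blast
qed

lemma has_real_derivative_zero_of_le_square:
  fixes f :: "real \<Rightarrow> real"
  assumes "\<And>t. \<bar>f t\<bar> \<le> C * (t - a)\<^sup>2"
  shows "(f has_real_derivative 0) (at a)"
proof -
  have fa: "f a = 0"
    using assms[of a] by simp
  have "((\<lambda>h. (f (a + h) - f a) / h) \<longlongrightarrow> 0) (at 0)"
  proof (rule Lim_null_comparison)
    show "\<forall>\<^sub>F h in at 0. norm ((f (a + h) - f a) / h) \<le> C * \<bar>h\<bar>"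
    proof (intro eventually_at_filter[THEN iffD2] always_eventually allI impI)
      fix h :: real assume "h \<noteq> 0"
      then have "\<bar>f (a + h)\<bar> / \<bar>h\<bar> \<le> C * h\<^sup>2 / \<bar>h\<bar>"
        using assms[of "a + h"] by (intro divide_right_mono) auto
      then show "norm ((f (a + h) - f a) / h) \<le> C * \<bar>h\<bar>"
        using \<open>h \<noteq> 0\<close> fa by (simp add: field_simps power2_eq_square)
    qed
    show "((\<lambda>h. C * \<bar>h\<bar>) \<longlongrightarrow> 0) (at 0)"
      by (auto intro!: tendsto_eq_intros)
  qed
  then show ?thesis
    by (simp add: DERIV_def)
qed

text \<open>The polynomial on the right is the numerator that results when the product rule is put
  over the common power \<open>n + 2\<close> of
  \<open>inverse (\<delta>\<^sup>2 - t\<^sup>2)\<close>. Inside and outside the interval this is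
  plain calculus; at the endpoints quadratic decay gives derivative zero.\<close>

lemma DERIV_bump_fun:
  assumes "\<delta> > 0"
  shows "(bump_fun \<delta> p n has_real_derivative
     bump_fun \<delta> (pderiv p * [:\<delta>\<^sup>2, 0, -1:]\<^sup>2 + smult (2 * real n) ([:0, 1:] * [:\<delta>\<^sup>2, 0, -1:] * p)
       - smult 2 ([:0, 1:] * p)) (n + 2) t) (at t)"
proof -
  consider "\<bar>t\<bar> < \<delta>" | "\<bar>t\<bar> > \<delta>" | "\<bar>t\<bar> = \<delta>"
    by linarith
  then show ?thesis
  proof cases
    case 1
    define s where "s = \<delta>\<^sup>2 - t\<^sup>2"
    have s: "s > 0"
      using 1 power_strict_mono[of "\<bar>t\<bar>" \<delta> 2] by (simp add: s_def)
    have *: "((\<lambda>t. poly p t * inverse (\<delta>\<^sup>2 - t\<^sup>2) ^ n * exp (- inverse (\<delta>\<^sup>2 - t\<^sup>2))) has_real_derivative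
        (poly (pderiv p) t * inverse s ^ n + poly p t * (real n * inverse s ^ (n + 1) * (2 * t)))
         * exp (- inverse s) + poly p t * inverse s ^ n * (exp (- inverse s) * (- 2 * t * inverse s ^ 2)))
        (at t)"
    proof -
      define u where "u = (\<lambda>t. inverse (\<delta>\<^sup>2 - t\<^sup>2))"
      have u: "(u has_real_derivative 2 * t * u t ^ 2) (at t)"
        using s unfolding u_def s_def
        by (auto intro!: derivative_eq_intros simp: power2_eq_square)
      have pw: "((\<lambda>t. u t ^ n) has_real_derivative 2 * t * (real n * u t ^ (n + 1))) (at t)"
        using DERIV_power[OF u, of n] by (cases n) (simp_all add: power2_eq_square mult_ac)
      have "((\<lambda>t. poly p t * u t ^ n * exp (- u t)) has_real_derivative
         (poly (pderiv p) t * u t ^ n + poly p t * (real n * u t ^ (n + 1) * (2 * t)))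
         * exp (- u t) + poly p t * u t ^ n * (exp (- u t) * (- 2 * t * u t ^ 2))) (at t)"
        by (rule DERIV_cong[OF DERIV_mult[OF DERIV_mult[OF poly_DERIV pw] DERIV_fun_exp[OF DERIV_minus[OF u]]]])
          (simp add: algebra_simps)
      then show ?thesis
        by (simp add: u_def s_def)
    qed
    have eq: "(poly (pderiv p) t * inverse s ^ n + poly p t * (real n * inverse s ^ (n + 1) * (2 * t)))
         * exp (- inverse s) + poly p t * inverse s ^ n * (exp (- inverse s) * (- 2 * t * inverse s ^ 2))
       = (poly (pderiv p) t * s\<^sup>2 + 2 * real n * (t * s * poly p t) - 2 * (t * poly p t))
          * inverse s ^ (n + 2) * exp (- inverse s)"
      using s by (simp add: field_simps power_add power2_eq_square)
    show ?thesis
    proof (rule has_field_derivative_transform_within_open)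
      show "open {-\<delta><..<\<delta>}" "t \<in> {-\<delta><..<\<delta>}"
        using 1 by auto
      show "((\<lambda>t. poly p t * inverse (\<delta>\<^sup>2 - t\<^sup>2) ^ n * exp (- inverse (\<delta>\<^sup>2 - t\<^sup>2))) has_real_derivative
        bump_fun \<delta> (pderiv p * [:\<delta>\<^sup>2, 0, -1:]\<^sup>2 + smult (2 * real n) ([:0, 1:] * [:\<delta>\<^sup>2, 0, -1:] * p)
       - smult 2 ([:0, 1:] * p)) (n + 2) t) (at t)"
        using *[unfolded eq] 1
        by (simp add: bump_fun_def s_def power2_eq_square algebra_simps del: mult_pCons_left mult_pCons_right)
    qed (auto simp: bump_fun_def)
  next
    case 2
    show ?thesis
    proof (rule has_field_derivative_transform_within_open)
      show "open (- {-\<delta>..\<delta>})" "t \<in> - {-\<delta>..\<delta>}"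
        using 2 by auto
      show "((\<lambda>t. 0) has_real_derivative
        bump_fun \<delta> (pderiv p * [:\<delta>\<^sup>2, 0, -1:]\<^sup>2 + smult (2 * real n) ([:0, 1:] * [:\<delta>\<^sup>2, 0, -1:] * p)
       - smult 2 ([:0, 1:] * p)) (n + 2) t) (at t)"
        using 2 by (simp add: bump_fun_def)
    qed (auto simp: bump_fun_def)
  next
    case 3
    obtain C where C: "\<And>t. \<bar>bump_fun \<delta> p n t\<bar> \<le> C * (\<delta>\<^sup>2 - t\<^sup>2)\<^sup>2"
      using bump_fun_le_square[OF assms] by blast
    have "C * (\<delta>\<^sup>2 - 0\<^sup>2)\<^sup>2 \<ge> 0"
      using C[of 0] by linarith
    then have C0: "C \<ge> 0"
      using assms by (simp add: zero_le_mult_iff)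
    \<comment> \<open>At an endpoint \<open>\<delta>\<^sup>2 = t\<^sup>2\<close>, so
      \<open>\<delta>\<^sup>2 - r\<^sup>2\<close> factors as \<open>(t + r) * (t - r)\<close>. The
      first factor is bounded by \<open>2 * \<delta>\<close>, the second gives quadratic decay in
      \<open>r - t\<close>.\<close>
    have "\<bar>bump_fun \<delta> p n r\<bar> \<le> (C * (2 * \<delta>)\<^sup>2) * (r - t)\<^sup>2" for r
    proof (cases "\<bar>r\<bar> < \<delta>")
      case True
      have "\<delta>\<^sup>2 = t\<^sup>2"
        using 3 by auto
      then have "(\<delta>\<^sup>2 - r\<^sup>2)\<^sup>2 = (t + r)\<^sup>2 * (r - t)\<^sup>2"
        by (simp add: power2_eq_square algebra_simps)
      moreover have "(t + r)\<^sup>2 \<le> (2 * \<delta>)\<^sup>2"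
        using True 3 by (intro abs_le_square_iff[THEN iffD1]) auto
      ultimately have "C * (\<delta>\<^sup>2 - r\<^sup>2)\<^sup>2 \<le> C * ((2 * \<delta>)\<^sup>2 * (r - t)\<^sup>2)"
        using C0 by (simp add: mult_left_mono mult_right_mono)
      then show ?thesis
        using C[of r] by (simp add: mult.assoc)
    next
      case False
      then show ?thesis
        using C0 by (simp add: bump_fun_def)
    qed
    then have "(bump_fun \<delta> p n has_real_derivative 0) (at t)"
      by (rule has_real_derivative_zero_of_le_square)
    moreover have "bump_fun \<delta> q m t = 0" for q m
      using 3 by (simp add: bump_fun_def)
    ultimately show ?thesis
      by simp
  qed
qed

section \<open>Mollifiers and product test functions\<close>

text \<open>Here \<open>b n\<close> is the derivative of order \<open>n\<close> of the kernel
  \<open>b 0\<close>. Carrying the whole sequence makes every derivative of a mollification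
  available as a convolution.\<close>

definition mollifier :: "real \<Rightarrow> (nat \<Rightarrow> real \<Rightarrow> real) \<Rightarrow> bool" where
  "mollifier \<delta> b \<longleftrightarrow>
     (\<forall>n s. (b n has_real_derivative b (Suc n) s) (at s)) \<and> (\<forall>n s. \<bar>s\<bar> \<ge> \<delta> \<longrightarrow> b n s = 0) \<and>
     (\<forall>s. 0 \<le> b 0 s) \<and> integrable lborel (b 0) \<and> integral\<^sup>L lborel (b 0) = 1"

lemma integrable_compact_support:
  fixes f :: "'a::euclidean_space \<Rightarrow> real"
  assumes "continuous_on UNIV f" "compact S" "\<And>z. z \<notin> S \<Longrightarrow> f z = 0"
  shows "integrable lborel f"
proof -
  have "integrable lborel (\<lambda>x. indicator S x *\<^sub>R f x)"
    using assms borel_integrable_compact continuous_on_subset by blast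
  moreover have "(\<lambda>x. indicator S x *\<^sub>R f x) = f"
    using assms(3) by (fastforce simp: indicator_def)
  ultimately show ?thesis
    by simp
qed

lemma mollifier_exists:
  assumes "\<delta> > 0"
  obtains b where "mollifier \<delta> b"
proof -
  \<comment> \<open>The numerators of the successive derivatives of the standard bump. Each
    differentiation raises the exponent by 2, hence the exponent \<open>2 * n\<close> at stage
    \<open>n\<close>.\<close>
  define P :: "nat \<Rightarrow> real poly" where
    "P = rec_nat 1 (\<lambda>n p. pderiv p * [:\<delta>\<^sup>2, 0, -1:]\<^sup>2
       + smult (2 * real (2 * n)) ([:0, 1:] * [:\<delta>\<^sup>2, 0, -1:] * p) - smult 2 ([:0, 1:] * p))"
  define \<theta> where "\<theta> = (\<lambda>n. bump_fun \<delta> (P n) (2 * n))"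
  have der: "(\<theta> n has_real_derivative \<theta> (Suc n) s) (at s)" for n s
    using DERIV_bump_fun[OF assms, of "P n" "2 * n" s] by (simp add: \<theta>_def P_def)
  have zero: "\<theta> n s = 0" if "\<bar>s\<bar> \<ge> \<delta>" for n s
    using that by (simp add: \<theta>_def bump_fun_def)
  have nonneg: "0 \<le> \<theta> 0 s" for s
    by (simp add: \<theta>_def bump_fun_def P_def)
  have cont: "continuous_on UNIV (\<theta> 0)"
    using der DERIV_isCont by (intro continuous_at_imp_continuous_on) blast
  have int: "integrable lborel (\<theta> 0)"
    by (rule integrable_compact_support[OF cont compact_Icc[of "-\<delta>" \<delta>]]) (auto intro!: zero)
  define I where "I = integral\<^sup>L lborel (\<theta> 0)"
  \<comment> \<open>The bump is strictly positive on the open interval, which would otherwise be a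
    null set.\<close>
  have "I \<noteq> 0"
  proof
    assume "I = 0"
    then have "AE s in lborel. \<theta> 0 s = 0"
      using integral_nonneg_eq_0_iff_AE[OF int] nonneg by (simp add: I_def)
    then have "AE s in lborel. s \<notin> {-\<delta><..<\<delta>}"
      by eventually_elim (auto simp: \<theta>_def bump_fun_def P_def abs_less_iff)
    then have "emeasure lborel {-\<delta><..<\<delta>} = 0"
      by (subst (asm) AE_iff_measurable[OF _ refl]) (auto simp: Collect_conj_eq greaterThanLessThan_def greaterThan_def lessThan_def)
    then show False
      using assms by simp
  qed
  moreover have "I \<ge> 0"
    unfolding I_def using nonneg by (intro integral_nonneg_AE) auto
  ultimately have I: "I > 0"
    by simp
  have "mollifier \<delta> (\<lambda>n s. \<theta> n s / I)"
    unfolding mollifier_def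
    using I nonneg zero int der by (auto intro!: DERIV_cdivide simp: I_def[symmetric])
  then show ?thesis
    by (rule that)
qed

lemma pdt_prod:
  assumes "\<And>s. (p has_real_derivative p' s) (at s)"
  shows "pdt (\<lambda>(s, y). p s * q y) = (\<lambda>(s, y). p' s * q y)"
  unfolding pdt_def using assms by (auto intro!: ext DERIV_imp_deriv derivative_eq_intros)

lemma pdx_prod:
  assumes "\<And>s. (q has_real_derivative q' s) (at s)"
  shows "pdx (\<lambda>(s, y). p s * q y) = (\<lambda>(s, y). p s * q' y)"
  unfolding pdx_def using assms by (auto intro!: ext DERIV_imp_deriv derivative_eq_intros)

text \<open>Each partial derivative of \<open>p i s * q j y\<close> has the same form with one index
  raised, so the induction on \<open>k\<close> runs over all \<open>i\<close> and \<open>j\<close>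
  at once.\<close>

lemma Ck_prod:
  assumes "\<And>n s. (p n has_real_derivative p (Suc n) s) (at s)"
    and "\<And>n s. (q n has_real_derivative q (Suc n) s) (at s)"
  shows "Ck k (\<lambda>(s, y). p i s * q j y)"
proof (induction k arbitrary: i j)
  case 0
  have "continuous_on UNIV (p i)" "continuous_on UNIV (q j)"
    using assms DERIV_isCont by (blast intro: continuous_at_imp_continuous_on)+
  then show ?case
    by (auto simp: case_prod_beta' intro!: continuous_intros elim: continuous_on_compose2)
next
  case (Suc k)
  have "(\<lambda>(s, y). p i s * q j y) differentiable (at z)" for z
  proof -
    have "p i differentiable (at (fst z))" "q j differentiable (at (snd z))"
      using assms real_differentiable_def by blast+
    then have "(\<lambda>z. p i (fst z)) differentiable (at z)" "(\<lambda>z. q j (snd z)) differentiable (at z)"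
      using differentiable_compose[of "p i" fst z] differentiable_compose[of "q j" snd z]
      by (auto intro: bounded_linear_imp_differentiable bounded_linear_fst bounded_linear_snd)
    then show ?thesis
      by (simp add: case_prod_beta')
  qed
  then show ?case
    using Suc pdt_prod[OF assms(1), where q = "q j"] pdx_prod[OF assms(2), where p = "p i"] by auto
qed

lemma iterated_pd_prod:
  assumes "\<And>n s. (p n has_real_derivative p (Suc n) s) (at s)"
    and "\<And>n s. (q n has_real_derivative q (Suc n) s) (at s)"
  shows "(pdt ^^ i) ((pdx ^^ j) (\<lambda>(s, y). p 0 s * q 0 y)) = (\<lambda>(s, y). p i s * q j y)"
proof -
  have x: "(pdx ^^ j) (\<lambda>(s, y). p 0 s * q 0 y) = (\<lambda>(s, y). p 0 s * q j y)"
    by (induction j) (auto simp: pdx_prod[OF assms(2)])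
  show ?thesis
    unfolding x by (induction i) (auto simp: pdt_prod[OF assms(1)])
qed

subsection \<open>The estimate for smooth functions\<close>

text \<open>For fixed \<open>t\<close>, the fundamental theorem of calculus on an interval reaching
  beyond \<open>S\<close> gives zero, as \<open>H\<close> vanishes at both ends; Fubini then
  integrates over \<open>t\<close>.\<close>

lemma integral_pdx_eq_0:
  fixes H H' :: "real \<times> real \<Rightarrow> real"
  assumes H': "continuous_on UNIV H'" and S: "compact S"
    and zero: "\<And>z. z \<notin> S \<Longrightarrow> H z = 0" "\<And>z. z \<notin> S \<Longrightarrow> H' z = 0"
    and der: "\<And>t x. ((\<lambda>y. H (t, y)) has_real_derivative H' (t, x)) (at x)"
  shows "integral\<^sup>L lborel H' = 0"
proof -
  obtain R where R: "\<And>z. z \<in> S \<Longrightarrow> norm z \<le> R"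
    using compact_imp_bounded[OF S] unfolding bounded_iff by blast
  define r where "r = \<bar>R\<bar> + 1"
  have out: "(t, x) \<notin> S" if "\<bar>x\<bar> \<ge> r" for t x
    using R[of "(t, x)"] that norm_snd_le[of x t] by (auto simp: r_def)
  have "(\<integral>x. H' (t, x) \<partial>lborel) = 0" for t
  proof -
    have "(\<integral>x. H' (t, x) \<partial>lborel) = (\<integral>x. H' (t, x) * indicator {-r .. r} x \<partial>lborel)"
      by (intro Bochner_Integration.integral_cong refl) (auto simp: indicator_def intro!: zero out)
    also have "\<dots> = H (t, r) - H (t, -r)"
      using der continuous_on_compose2[OF H', of UNIV "\<lambda>x. (t, x)"]
      by (intro integral_FTC_Icc_real)
        (auto simp: r_def continuous_on_eq_continuous_at intro!: continuous_intros)
    also have "\<dots> = 0"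
      using zero(1)[OF out, of r t] zero(1)[OF out, of "-r" t] by (simp add: r_def)
    finally show ?thesis .
  qed
  moreover have "integrable (lborel \<Otimes>\<^sub>M lborel) H'"
    unfolding lborel_prod by (rule integrable_compact_support[OF H' S zero(2)])
  ultimately show ?thesis
    using lborel_pair.integral_fst'[of H'] by (simp add: lborel_prod)
qed

text \<open>Reduces to the previous case by exchanging the coordinates, which preserves Lebesgue
  measure.\<close>

lemma integral_pdt_eq_0:
  fixes H H' :: "real \<times> real \<Rightarrow> real"
  assumes H': "continuous_on UNIV H'" and S: "compact S"
    and zero: "\<And>z. z \<notin> S \<Longrightarrow> H z = 0" "\<And>z. z \<notin> S \<Longrightarrow> H' z = 0"
    and der: "\<And>t x. ((\<lambda>s. H (s, x)) has_real_derivative H' (t, x)) (at t)"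
  shows "integral\<^sup>L lborel H' = 0"
proof -
  have "integral\<^sup>L lborel (\<lambda>z. H' (prod.swap z)) = 0"
    by (rule integral_pdx_eq_0[of _ "prod.swap ` S" "\<lambda>z. H (prod.swap z)"])
      (auto simp: der intro!: continuous_on_compose2[OF H'] compact_continuous_image S
          continuous_on_swap zero intro: rev_image_eqI)
  moreover have "integral\<^sup>L lborel (\<lambda>z. H' (prod.swap z)) = integral\<^sup>L lborel H'"
    using lborel_pair.integral_product_swap[of H'] borel_measurable_continuous_onI[OF H']
    by (simp add: lborel_prod case_prod_beta' prod.swap_def)
  ultimately show ?thesis
    by simp
qed

text \<open>A jet stands for the array of all partial derivatives \<open>\<partial>\<^sub>t\<^sup>i \<partial>\<^sub>x\<^sup>j\<close> of a function.\<close>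

type_synonym jet = "nat \<Rightarrow> nat \<Rightarrow> real \<times> real \<Rightarrow> real"

section \<open>Calculus of jets\<close>

definition smooth_jet :: "(real \<times> real) set \<Rightarrow> jet \<Rightarrow> bool" where
  "smooth_jet S F \<longleftrightarrow>
     (\<forall>i j. continuous_on UNIV (F i j)) \<and> (\<forall>i j z. z \<notin> S \<longrightarrow> F i j z = 0) \<and>
     (\<forall>i j t x. ((\<lambda>s. F i j (s, x)) has_real_derivative F (Suc i) j (t, x)) (at t)) \<and>
     (\<forall>i j t x. ((\<lambda>y. F i j (t, y)) has_real_derivative F i (Suc j) (t, x)) (at x))"

definition jdx :: "jet \<Rightarrow> jet" where "jdx F = (\<lambda>i j. F i (Suc j))"

definition jdt :: "jet \<Rightarrow> jet" where "jdt F = (\<lambda>i j. F (Suc i) j)"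

text \<open>The Leibniz rule for multiplication by \<open>x - x0\<close>: the factor has derivative
  one and no higher ones, which gives the second summand. For \<open>j = 0\<close> the truncated
  index \<open>j - 1\<close> is harmless because of the coefficient \<open>real j\<close>. The
  definition of \<open>jmt\<close> is the analogue in \<open>t\<close>.\<close>

definition jmx :: "real \<Rightarrow> jet \<Rightarrow> jet" where
  "jmx x0 F = (\<lambda>i j z. (snd z - x0) * F i j z + real j * F i (j - 1) z)"

definition jmt :: "real \<Rightarrow> jet \<Rightarrow> jet" where
  "jmt t0 F = (\<lambda>i j z. (fst z - t0) * F i j z + real i * F (i - 1) j z)"

definition jlin :: "real \<Rightarrow> jet \<Rightarrow> real \<Rightarrow> jet \<Rightarrow> jet" where
  "jlin a F b G = (\<lambda>i j z. a * F i j z + b * G i j z)"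

lemma smooth_jet_jdx: "smooth_jet S F \<Longrightarrow> smooth_jet S (jdx F)"
  by (auto simp: smooth_jet_def jdx_def)

lemma smooth_jet_jdt: "smooth_jet S F \<Longrightarrow> smooth_jet S (jdt F)"
  by (auto simp: smooth_jet_def jdt_def)

lemma smooth_jet_cont: "smooth_jet S F \<Longrightarrow> continuous_on UNIV (F i j)"
  by (simp add: smooth_jet_def)

lemma smooth_jet_zero: "smooth_jet S F \<Longrightarrow> z \<notin> S \<Longrightarrow> F i j z = 0"
  by (cases z) (simp add: smooth_jet_def)

lemma smooth_jet_DERIV:
  assumes "smooth_jet S F"
  shows "((\<lambda>s. F i j (s, x)) has_real_derivative F (Suc i) j (t, x)) (at t)"
    and "((\<lambda>y. F i j (t, y)) has_real_derivative F i (Suc j) (t, x)) (at x)"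
  using assms by (simp_all add: smooth_jet_def)

lemma smooth_jet_jlin:
  assumes "smooth_jet S F" "smooth_jet S G"
  shows "smooth_jet S (jlin a F b G)"
proof -
  have "continuous_on UNIV (jlin a F b G i j)" for i j
    using assms unfolding smooth_jet_def jlin_def by (auto intro!: continuous_intros)
  moreover have "jlin a F b G i j z = 0" if "z \<notin> S" for i j z
    using assms that by (simp add: smooth_jet_zero jlin_def)
  ultimately show ?thesis
    unfolding smooth_jet_def
    by (auto simp: jlin_def intro!: DERIV_add DERIV_cmult smooth_jet_DERIV[OF assms(1)] smooth_jet_DERIV[OF assms(2)])
qed

lemma smooth_jet_jmx:
  assumes "smooth_jet S F" shows "smooth_jet S (jmx x0 F)"
proof -
  have 1: "((\<lambda>s. jmx x0 F i j (s, x)) has_real_derivative jmx x0 F (Suc i) j (t, x)) (at t)" for i j t x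
    using smooth_jet_DERIV(1)[OF assms] by (auto simp: jmx_def intro!: DERIV_add DERIV_cmult)
  have 2: "((\<lambda>y. jmx x0 F i j (t, y)) has_real_derivative jmx x0 F i (Suc j) (t, x)) (at x)" for i j t x
  proof -
    have d: "((\<lambda>y. F i j (t, y)) has_real_derivative F i (Suc j) (t, x)) (at x)" for j
      using assms by (simp add: smooth_jet_def)
    show ?thesis
      using d[of "j - 1"] unfolding jmx_def
      by (cases j) (auto intro!: derivative_eq_intros d simp: algebra_simps)
  qed
  show ?thesis
    using assms 1 2 unfolding smooth_jet_def by (auto simp: jmx_def intro!: continuous_intros)
qed

lemma smooth_jet_jmt:
  assumes "smooth_jet S F" shows "smooth_jet S (jmt t0 F)"
proof -
  have 1: "((\<lambda>y. jmt t0 F i j (t, y)) has_real_derivative jmt t0 F i (Suc j) (t, x)) (at x)" for i j t x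
    using smooth_jet_DERIV(2)[OF assms] by (auto simp: jmt_def intro!: DERIV_add DERIV_cmult)
  have 2: "((\<lambda>s. jmt t0 F i j (s, x)) has_real_derivative jmt t0 F (Suc i) j (t, x)) (at t)" for i j t x
  proof -
    have d: "((\<lambda>s. F i j (s, x)) has_real_derivative F (Suc i) j (t, x)) (at t)" for i
      using assms by (simp add: smooth_jet_def)
    show ?thesis
      using d[of "i - 1"] unfolding jmt_def
      by (cases i) (auto intro!: derivative_eq_intros d simp: algebra_simps)
  qed
  show ?thesis
    using assms 1 2 unfolding smooth_jet_def by (auto simp: jmt_def intro!: continuous_intros)
qed

section \<open>The weighted inner product and its adjoints\<close>

locale carleman_weight =
  fixes \<Lambda> x0 t0 \<beta> :: real and S :: "(real \<times> real) set"
  assumes S: "compact S"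
begin

definition W :: "real \<times> real \<Rightarrow> real" where "W z = exp (2 * \<Lambda> * \<psi> x0 t0 \<beta> z)"

text \<open>Only the entries of order zero are paired; the other entries make it possible to apply
  differential operators before pairing.\<close>

definition ip :: "jet \<Rightarrow> jet \<Rightarrow> real" where
  "ip F G = (\<integral>z. W z * (F 0 0 z * G 0 0 z) \<partial>lborel)"

abbreviation "N F \<equiv> ip F F"

text \<open>With respect to \<open>ip\<close>, the adjoints of \<open>\<partial>\<^sub>x\<close> and \<open>\<partial>\<^sub>t\<close> are \<open>- B\<close> and \<open>- E\<close>.\<close>

definition B :: "jet \<Rightarrow> jet" where "B F = jlin 1 (jdx F) (4 * \<Lambda>) (jmx x0 F)"

definition E :: "jet \<Rightarrow> jet" where "E F = jlin 1 (jdt F) (- 4 * \<Lambda> * \<beta>) (jmt t0 F)"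

abbreviation "good \<equiv> smooth_jet S"

lemma good_B: "good F \<Longrightarrow> good (B F)"
  by (simp add: B_def smooth_jet_jlin smooth_jet_jdx smooth_jet_jmx)

lemma good_E: "good F \<Longrightarrow> good (E F)"
  by (simp add: E_def smooth_jet_jlin smooth_jet_jdt smooth_jet_jmt)

lemmas good_intros = good_B good_E smooth_jet_jdx smooth_jet_jdt smooth_jet_jlin

lemma continuous_W: "continuous_on UNIV W"
  unfolding W_def \<psi>_def case_prod_beta' by (intro continuous_intros)

lemma W_pos: "W z > 0"
  by (simp add: W_def)

lemma ip_integrable:
  assumes "good F" "good G"
  shows "integrable lborel (\<lambda>z. W z * (F i j z * G k l z))"
  by (intro integrable_compact_support[OF _ S] continuous_intros continuous_W
      smooth_jet_cont[OF assms(1)] smooth_jet_cont[OF assms(2)])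
    (simp add: smooth_jet_zero[OF assms(1)])

lemma ip_commute: "ip F G = ip G F"
  by (simp add: ip_def mult.commute)

lemma N_nonneg: "N F \<ge> 0"
  unfolding ip_def using W_pos by (intro integral_nonneg_AE) (auto simp: less_imp_le)

lemma ip_jlin:
  assumes "good F" "good G" "good H"
  shows "ip H (jlin a F b G) = a * ip H F + b * ip H G"
proof -
  have "ip H (jlin a F b G)
      = (\<integral>z. a * (W z * (H 0 0 z * F 0 0 z)) + b * (W z * (H 0 0 z * G 0 0 z)) \<partial>lborel)"
    by (simp add: ip_def jlin_def algebra_simps)
  then show ?thesis
    using ip_integrable[OF assms(3,1)] ip_integrable[OF assms(3,2)] by (simp add: ip_def)
qed

lemma N_jlin:
  assumes "good F" "good G"
  shows "N (jlin a F b G) = a\<^sup>2 * N F + 2 * a * b * ip F G + b\<^sup>2 * N G"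
proof -
  let ?J = "jlin a F b G"
  have "N ?J = a * ip ?J F + b * ip ?J G"
    using assms by (intro ip_jlin smooth_jet_jlin)
  moreover have "ip ?J F = a * N F + b * ip F G" "ip ?J G = a * ip F G + b * N G"
    using assms ip_jlin[OF assms, of F a b] ip_jlin[OF assms, of G a b]
    by (simp_all only: ip_commute[of ?J F] ip_commute[of ?J G] ip_commute[of G F])
  ultimately show ?thesis
    by (simp add: algebra_simps power2_eq_square)
qed

text \<open>The \<open>x\<close>-derivative of the weighted product integrates to zero.
  Differentiating the weight produces the factor \<open>4 * \<Lambda> * (x - x0)\<close>, which is
  the zeroth-order term of \<open>B\<close>.\<close>

lemma ip_jdx:
  assumes "good F" "good G"
  shows "ip (jdx F) G = - ip F (B G)"
proof -
  define H where "H = (\<lambda>z. W z * (F 0 0 z * G 0 0 z))"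
  define H' where "H' = (\<lambda>z. W z * (jdx F 0 0 z * G 0 0 z) + W z * (F 0 0 z * B G 0 0 z))"
  have F: "((\<lambda>y. F 0 0 (t, y)) has_real_derivative F 0 (Suc 0) (t, x)) (at x)"
    and G: "((\<lambda>y. G 0 0 (t, y)) has_real_derivative G 0 (Suc 0) (t, x)) (at x)" for t x
    using assms by (auto simp: smooth_jet_def)
  have "integral\<^sup>L lborel H' = 0"
  proof (rule integral_pdx_eq_0[OF _ S])
    show "continuous_on UNIV H'"
      unfolding H'_def
      by (intro continuous_intros continuous_W smooth_jet_cont[OF assms(1)] smooth_jet_cont[OF assms(2)]
          smooth_jet_cont[OF smooth_jet_jdx[OF assms(1)]] smooth_jet_cont[OF good_B[OF assms(2)]])
    show "H' z = 0" "H z = 0" if "z \<notin> S" for z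
      using that smooth_jet_jdx[OF assms(1)] good_B[OF assms(2)] assms
      by (simp_all add: H'_def H_def smooth_jet_zero[OF _ that])
    have W: "((\<lambda>y. W (t, y)) has_real_derivative 4 * \<Lambda> * (x - x0) * W (t, x)) (at x)" for t x
      unfolding W_def \<psi>_def by (auto intro!: derivative_eq_intros simp: algebra_simps)
    show "((\<lambda>y. H (t, y)) has_real_derivative H' (t, x)) (at x)" for t x
      unfolding H_def H'_def
      by (rule DERIV_cong[OF DERIV_mult[OF W DERIV_mult[OF F G]]])
        (simp add: jdx_def B_def jlin_def jmx_def algebra_simps)
  qed
  then show ?thesis
    using ip_integrable[OF smooth_jet_jdx[OF assms(1)] assms(2), of 0 0 0 0]
      ip_integrable[OF assms(1) good_B[OF assms(2)], of 0 0 0 0]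
    by (simp add: H'_def ip_def)
qed

lemma ip_jdt:
  assumes "good F" "good G"
  shows "ip (jdt F) G = - ip F (E G)"
proof -
  define H where "H = (\<lambda>z. W z * (F 0 0 z * G 0 0 z))"
  define H' where "H' = (\<lambda>z. W z * (jdt F 0 0 z * G 0 0 z) + W z * (F 0 0 z * E G 0 0 z))"
  have F: "((\<lambda>s. F 0 0 (s, x)) has_real_derivative F (Suc 0) 0 (t, x)) (at t)"
    and G: "((\<lambda>s. G 0 0 (s, x)) has_real_derivative G (Suc 0) 0 (t, x)) (at t)" for t x
    using assms by (auto simp: smooth_jet_def)
  have "integral\<^sup>L lborel H' = 0"
  proof (rule integral_pdt_eq_0[OF _ S])
    show "continuous_on UNIV H'"
      unfolding H'_def
      by (intro continuous_intros continuous_W smooth_jet_cont[OF assms(1)] smooth_jet_cont[OF assms(2)]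
          smooth_jet_cont[OF smooth_jet_jdt[OF assms(1)]] smooth_jet_cont[OF good_E[OF assms(2)]])
    show "H' z = 0" "H z = 0" if "z \<notin> S" for z
      using that smooth_jet_jdt[OF assms(1)] good_E[OF assms(2)] assms
      by (simp_all add: H'_def H_def smooth_jet_zero[OF _ that])
    have W: "((\<lambda>s. W (s, x)) has_real_derivative - 4 * \<Lambda> * \<beta> * (t - t0) * W (t, x)) (at t)" for t x
      unfolding W_def \<psi>_def by (auto intro!: derivative_eq_intros simp: algebra_simps)
    show "((\<lambda>s. H (s, x)) has_real_derivative H' (t, x)) (at t)" for t x
      unfolding H_def H'_def
      by (rule DERIV_cong[OF DERIV_mult[OF W DERIV_mult[OF F G]]])
        (simp add: jdt_def E_def jlin_def jmt_def algebra_simps)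
  qed
  then show ?thesis
    using ip_integrable[OF smooth_jet_jdt[OF assms(1)] assms(2), of 0 0 0 0]
      ip_integrable[OF assms(1) good_E[OF assms(2)], of 0 0 0 0]
    by (simp add: H'_def ip_def)
qed

section \<open>Commutation relations and normal order\<close>

text \<open>The commutator comes from differentiating the factor \<open>x - x0\<close> in
  \<open>B\<close>, whose derivative is one.\<close>

lemma jdx_B: "jdx (B F) = jlin 1 (B (jdx F)) (4 * \<Lambda>) F"
proof (intro ext)
  fix i j z
  show "jdx (B F) i j z = jlin 1 (B (jdx F)) (4 * \<Lambda>) F i j z"
    by (cases j) (simp_all add: B_def jdx_def jlin_def jmx_def algebra_simps)
qed

lemma jdt_E: "jdt (E F) = jlin 1 (E (jdt F)) (- 4 * \<Lambda> * \<beta>) F"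
proof (intro ext)
  fix i j z
  show "jdt (E F) i j z = jlin 1 (E (jdt F)) (- 4 * \<Lambda> * \<beta>) F i j z"
    by (cases i) (simp_all add: E_def jdt_def jlin_def jmt_def algebra_simps)
qed

text \<open>The coefficients of \<open>B\<close> do not depend on \<open>t\<close>; this is where
  the separated form of \<open>\<psi>\<close> enters.\<close>

lemma jdt_B: "jdt (B F) = B (jdt F)"
  by (simp add: B_def jdt_def jdx_def jlin_def jmx_def)

text \<open>Integrating by parts once gives \<open>- ip F (B (jdx F))\<close>. The commutator
  exchanges the two operators at the price of \<open>4 * \<Lambda> * N F\<close>, and integrating by
  parts again gives \<open>N (B F)\<close>.\<close>

lemma N_jdx: "good F \<Longrightarrow> N (jdx F) = N (B F) + 4 * \<Lambda> * N F"
proof -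
  assume F: "good F"
  have "N (jdx F) = - ip F (B (jdx F))"
    using F by (simp add: ip_jdx good_intros)
  also have "\<dots> = - ip F (jdx (B F)) + 4 * \<Lambda> * N F"
    using F by (simp add: jdx_B ip_jlin good_intros)
  also have "ip F (jdx (B F)) = - N (B F)"
    using F by (subst ip_commute) (simp add: ip_jdx good_intros)
  finally show ?thesis
    by simp
qed

text \<open>The same computation in \<open>t\<close>, with the commutator
  \<open>- 4 * \<Lambda> * \<beta>\<close>. For positive \<open>\<Lambda>\<close> and
  \<open>\<beta>\<close> it is the source of the one term of unfavourable sign in the final
  identity.\<close>

lemma N_jdt: "good F \<Longrightarrow> N (jdt F) = N (E F) - 4 * \<Lambda> * \<beta> * N F"
proof -
  assume F: "good F"
  have "N (jdt F) = - ip F (E (jdt F))"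
    using F by (simp add: ip_jdt good_intros)
  also have "\<dots> = - ip F (jdt (E F)) - 4 * \<Lambda> * \<beta> * N F"
    using F by (simp add: jdt_E ip_jlin good_intros)
  also have "ip F (jdt (E F)) = - N (E F)"
    using F by (subst ip_commute) (simp add: ip_jdt good_intros)
  finally show ?thesis
    by simp
qed

lemma ip_jdx_B_pow:
  assumes "good F" "good G"
  shows "ip ((jdx ^^ k) F) G = (-1) ^ k * ip F ((B ^^ k) G)"
  using assms
proof (induction k arbitrary: F)
  case (Suc k)
  have "good ((B ^^ k) G)"
    using Suc.prems by (induction k) (auto intro: good_intros)
  then show ?case
    using Suc by (simp add: funpow_swap1[of jdx] ip_jdx good_intros)
qed auto

lemma good_funpow:
  "good F \<Longrightarrow> good ((jdx ^^ k) F)" "good F \<Longrightarrow> good ((B ^^ k) F)"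
  by (induction k) (auto intro: good_intros)

lemma ip_jdx_pow_B_pow: "good F \<Longrightarrow> ip F ((jdx ^^ k) ((B ^^ k) F)) = (-1) ^ k * N ((B ^^ k) F)"
  by (subst ip_commute) (simp add: ip_jdx_B_pow good_funpow)

text \<open>This is the normal-order expansion for the constant commutator
  \<open>4 * \<Lambda>\<close>. The coefficient of order \<open>k\<close> is \<open>(-1) ^ k * fact
  k * (4 choose k)\<^sup>2 * (4 * \<Lambda>) ^ k\<close>, which gives 64, 1152, 6144 and 6144 for
  \<open>k\<close> from 1 to 4.\<close>

lemma B_pow_jdx_pow_normal_order:
  "(B ^^ 4) ((jdx ^^ 4) F) 0 0 z = (jdx ^^ 4) ((B ^^ 4) F) 0 0 z
     - 64 * \<Lambda> * (jdx ^^ 3) ((B ^^ 3) F) 0 0 z + 1152 * \<Lambda>\<^sup>2 * (jdx ^^ 2) ((B ^^ 2) F) 0 0 z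
     - 6144 * \<Lambda> ^ 3 * jdx (B F) 0 0 z + 6144 * \<Lambda> ^ 4 * F 0 0 z"
  by (simp add: eval_nat_numeral B_def jdx_def jlin_def jmx_def algebra_simps)

text \<open>Moving four derivatives across turns the norm into
  \<open>ip F ((B ^^ 4) ((jdx ^^ 4) F))\<close>. After normal ordering, each term
  \<open>(jdx ^^ k) ((B ^^ k) F)\<close> contributes \<open>(-1) ^ k * N ((B ^^ k) F)\<close>, and
  this sign cancels the one of its coefficient.\<close>

lemma N_jdx_pow4:
  assumes F: "good F"
  shows "N ((jdx ^^ 4) F) = N ((B ^^ 4) F) + 64 * \<Lambda> * N ((B ^^ 3) F) + 1152 * \<Lambda>\<^sup>2 * N ((B ^^ 2) F)
     + 6144 * \<Lambda> ^ 3 * N (B F) + 6144 * \<Lambda> ^ 4 * N F"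
proof -
  let ?G = "\<lambda>k. (jdx ^^ k) ((B ^^ k) F)"
  have i: "integrable lborel (\<lambda>z. W z * (F 0 0 z * ?G k 0 0 z))" for k
    using F by (intro ip_integrable good_funpow)
  have "N ((jdx ^^ 4) F) = ip F ((B ^^ 4) ((jdx ^^ 4) F))"
    using F by (simp add: ip_jdx_B_pow good_funpow)
  also have "\<dots> = (\<integral>z. W z * (F 0 0 z * ?G 4 0 0 z) - 64 * \<Lambda> * (W z * (F 0 0 z * ?G 3 0 0 z))
      + 1152 * \<Lambda>\<^sup>2 * (W z * (F 0 0 z * ?G 2 0 0 z)) - 6144 * \<Lambda> ^ 3 * (W z * (F 0 0 z * ?G 1 0 0 z))
      + 6144 * \<Lambda> ^ 4 * (W z * (F 0 0 z * ?G 0 0 0 z)) \<partial>lborel)"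
    unfolding ip_def B_pow_jdx_pow_normal_order
    by (intro Bochner_Integration.integral_cong refl) (simp add: algebra_simps)
  also have "\<dots> = ip F (?G 4) - 64 * \<Lambda> * ip F (?G 3) + 1152 * \<Lambda>\<^sup>2 * ip F (?G 2)
      - 6144 * \<Lambda> ^ 3 * ip F (?G 1) + 6144 * \<Lambda> ^ 4 * ip F (?G 0)"
    using i[of 4] i[of 3] i[of 2] i[of 1] i[of 0] unfolding ip_def
    by (simp del: funpow.simps funpow_0 One_nat_def)
  finally show ?thesis
    unfolding ip_jdx_pow_B_pow[OF F] by simp
qed

lemma jdt_B_pow: "jdt ((B ^^ k) F) = (B ^^ k) (jdt F)"
  by (induction k) (simp_all add: jdt_B)

text \<open>The adjoint operator sends \<open>F\<close> to
  \<open>jlin (- \<gamma>) (E F) 1 ((B ^^ 4) F)\<close>. Both squared norms contain the same cross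
  term, so their difference consists of commutator terms only. The norm of the adjoint and the terms
  with one and two factors \<open>B\<close> are then dropped as nonnegative.\<close>

lemma N_operator_ge:
  assumes F: "good F" and "\<Lambda> \<ge> 0"
  shows "N (jlin \<gamma> (jdt F) 1 ((jdx ^^ 4) F))
     \<ge> 64 * \<Lambda> * N ((B ^^ 3) F) + (6144 * \<Lambda> ^ 4 - 4 * \<Lambda> * \<beta> * \<gamma>\<^sup>2) * N F"
proof -
  \<comment> \<open>Moving \<open>E\<close> across costs one sign; moving the four factors
    \<open>B\<close> across costs none. In between, \<open>jdt\<close> passes through the powers of
    \<open>B\<close>.\<close>
  have "ip (E F) ((B ^^ 4) F) = - ip (jdt ((B ^^ 4) F)) F"
    using F by (subst ip_commute) (simp add: ip_jdt good_funpow)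
  also have "ip (jdt ((B ^^ 4) F)) F = ip (jdt F) ((jdx ^^ 4) F)"
    unfolding jdt_B_pow ip_commute[of _ F] ip_commute[of "jdt F"]
    using F by (simp add: ip_jdx_B_pow good_intros)
  finally have cross: "ip (E F) ((B ^^ 4) F) = - ip (jdt F) ((jdx ^^ 4) F)" .
  have "N (jlin (- \<gamma>) (E F) 1 ((B ^^ 4) F))
      = \<gamma>\<^sup>2 * N (E F) + 2 * \<gamma> * ip (jdt F) ((jdx ^^ 4) F) + N ((B ^^ 4) F)"
    using F by (subst N_jlin) (simp_all add: good_intros good_funpow cross)
  moreover have "N (jlin \<gamma> (jdt F) 1 ((jdx ^^ 4) F))
      = \<gamma>\<^sup>2 * N (jdt F) + 2 * \<gamma> * ip (jdt F) ((jdx ^^ 4) F) + N ((jdx ^^ 4) F)"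
    using F by (subst N_jlin) (simp_all add: good_intros good_funpow)
  ultimately have "N (jlin \<gamma> (jdt F) 1 ((jdx ^^ 4) F))
      = N (jlin (- \<gamma>) (E F) 1 ((B ^^ 4) F)) - 4 * \<Lambda> * \<beta> * \<gamma>\<^sup>2 * N F + 64 * \<Lambda> * N ((B ^^ 3) F)
        + 1152 * \<Lambda>\<^sup>2 * N ((B ^^ 2) F) + 6144 * \<Lambda> ^ 3 * N (B F) + 6144 * \<Lambda> ^ 4 * N F"
    using N_jdt[OF F] N_jdx_pow4[OF F] by (simp add: algebra_simps)
  moreover have "0 \<le> 1152 * \<Lambda>\<^sup>2 * N ((B ^^ 2) F)" "0 \<le> 6144 * \<Lambda> ^ 3 * N (B F)"
    using assms(2) N_nonneg by auto
  ultimately show ?thesis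
    using N_nonneg[of "jlin (- \<gamma>) (E F) 1 ((B ^^ 4) F)"] by (simp add: algebra_simps)
qed

section \<open>Coercivity of \<open>B\<close>\<close>

text \<open>The parallelogram identity with the squared norm of the difference dropped.\<close>

lemma N_jlin_le:
  assumes "good F" "good G"
  shows "N (jlin a F b G) \<le> 2 * a\<^sup>2 * N F + 2 * b\<^sup>2 * N G"
  using N_jlin[OF assms, of a b] N_jlin[OF assms, of a "-b"] N_nonneg[of "jlin a F (-b) G"]
  by simp

text \<open>On the support, the distance \<open>x0 - x\<close> lies between \<open>x0 - L\<close>
  and \<open>x0\<close>.\<close>

lemma N_jmx:
  assumes F: "good F" and S: "S \<subseteq> {z. 0 \<le> snd z \<and> snd z \<le> L}" and L: "L < x0" "0 < L"
  shows "(x0 - L)\<^sup>2 * N F \<le> N (jmx x0 F)" "N (jmx x0 F) \<le> x0\<^sup>2 * N F"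
proof -
  note i1 = ip_integrable[OF F F, of 0 0 0 0]
    and i2 = ip_integrable[OF smooth_jet_jmx[OF F] smooth_jet_jmx[OF F], of x0 0 0 x0 0 0]
  have b: "(x0 - L)\<^sup>2 * (W z * (F 0 0 z * F 0 0 z)) \<le> W z * (jmx x0 F 0 0 z * jmx x0 F 0 0 z) \<and>
      W z * (jmx x0 F 0 0 z * jmx x0 F 0 0 z) \<le> x0\<^sup>2 * (W z * (F 0 0 z * F 0 0 z))" for z
  proof (cases "z \<in> S")
    case True
    have eq: "W z * (jmx x0 F 0 0 z * jmx x0 F 0 0 z) = (x0 - snd z)\<^sup>2 * (W z * (F 0 0 z * F 0 0 z))"
      by (simp add: jmx_def power2_eq_square algebra_simps)
    have "(x0 - L)\<^sup>2 \<le> (x0 - snd z)\<^sup>2" "(x0 - snd z)\<^sup>2 \<le> x0\<^sup>2"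
      using True S L by (auto intro!: power_mono)
    then show ?thesis
      unfolding eq using W_pos[of z] by (auto intro!: mult_right_mono simp: less_imp_le)
  next
    case False
    then show ?thesis
      using F by (simp add: smooth_jet_zero jmx_def)
  qed
  have "(\<integral>z. (x0 - L)\<^sup>2 * (W z * (F 0 0 z * F 0 0 z)) \<partial>lborel) \<le> N (jmx x0 F)"
    unfolding ip_def using i1 i2 b by (intro integral_mono) auto
  then show "(x0 - L)\<^sup>2 * N F \<le> N (jmx x0 F)"
    by (simp add: ip_def)
  have "N (jmx x0 F) \<le> (\<integral>z. x0\<^sup>2 * (W z * (F 0 0 z * F 0 0 z)) \<partial>lborel)"
    unfolding ip_def using i1 i2 b by (intro integral_mono) auto
  then show "N (jmx x0 F) \<le> x0\<^sup>2 * N F"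
    by (simp add: ip_def)
qed

lemma jdx_jmx: "jdx (jmx x0 F) = jlin 1 (jmx x0 (jdx F)) 1 F"
proof (intro ext)
  fix i j z
  show "jdx (jmx x0 F) i j z = jlin 1 (jmx x0 (jdx F)) 1 F i j z"
    by (cases j) (simp_all add: jdx_def jlin_def jmx_def algebra_simps)
qed

lemma jdx_eq: "jdx F = jlin 1 (B F) (- 4 * \<Lambda>) (jmx x0 F)"
  by (simp add: B_def jlin_def)

lemma jdx_jlin: "jdx (jlin a F b G) = jlin a (jdx F) b (jdx G)"
  by (simp add: jdx_def jlin_def)

text \<open>The constants record a chain of bounds: \<open>k\<close> bounds
  \<open>\<Lambda>\<^sup>2 * N G\<close> by \<open>N (B G)\<close>, while \<open>k1\<close>,
  \<open>c2\<close> and \<open>c3\<close> bound the norms of the first, second and third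
  \<open>x\<close>-derivatives by those of one, two and three factors \<open>B\<close>. None of them
  depends on \<open>\<Lambda>\<close>.\<close>

lemma coercivity:
  fixes L :: real
  assumes F: "good F" and S: "S \<subseteq> {z. 0 \<le> snd z \<and> snd z \<le> L}" and L: "L < x0" "0 < L"
    and \<Lambda>: "\<Lambda> \<ge> 1" "\<Lambda> * (x0 - L)\<^sup>2 \<ge> 1"
    and k: "k = 1 / (2 * (x0 - L)\<^sup>2)" "k1 = 1 + 4 * k" "c2 = 2 * k1 + 64 * x0\<^sup>2 * k1 * k + 64 * k\<^sup>2"
    and c3: "c3 = 2 * c2 + 64 * x0\<^sup>2 * c2 * k + 256 * k1 * k\<^sup>2"
  shows "\<Lambda> ^ 7 * N F + \<Lambda> ^ 5 * N (jdx F) + \<Lambda> ^ 3 * N ((jdx ^^ 2) F) + \<Lambda> * N ((jdx ^^ 3) F)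
     \<le> (k ^ 3 + k1 * k\<^sup>2 + c2 * k + c3) * (\<Lambda> * N ((B ^^ 3) F))"
proof -
  define d where "d = x0 - L"
  have d: "d > 0" using L by (simp add: d_def)
  have kpos: "k > 0" "k1 > 0" "c2 > 0"
    using d L unfolding k d_def by (auto intro!: add_pos_nonneg)
  \<comment> \<open>Since \<open>4 * \<Lambda> * (x - x0) * G\<close> is \<open>B G\<close> minus
    the derivative of \<open>G\<close>, its norm is controlled by
    \<open>4 * N (B G) + 8 * \<Lambda> * N G\<close>. The assumption
    \<open>\<Lambda> * (x0 - L)\<^sup>2 \<ge> 1\<close> absorbs the second summand into half of the
    left-hand side.\<close>
  have a: "\<Lambda>\<^sup>2 * N G \<le> k * N (B G)" if G: "good G" for G
  proof -
    have g: "good (jdx G)" "good (B G)" "good (jmx x0 G)"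
      using G by (auto intro: good_intros smooth_jet_jmx)
    have "16 * \<Lambda>\<^sup>2 * N (jmx x0 G) = N (jlin 1 (B G) (-1) (jdx G))"
    proof -
      have "jlin 1 (B G) (-1) (jdx G) = jlin (4 * \<Lambda>) (jmx x0 G) 0 G"
        by (simp add: B_def jlin_def)
      then show ?thesis
        using N_jlin[OF g(3) G, of "4 * \<Lambda>" 0] by (simp add: power_mult_distrib)
    qed
    also have "\<dots> \<le> 4 * N (B G) + 8 * \<Lambda> * N G"
      using N_jlin_le[OF g(2,1), of 1 "-1"] N_jdx[OF G] by simp
    finally have "16 * \<Lambda>\<^sup>2 * N (jmx x0 G) \<le> 4 * N (B G) + 8 * \<Lambda> * N G" .
    moreover have "16 * \<Lambda>\<^sup>2 * (d\<^sup>2 * N G) \<le> 16 * \<Lambda>\<^sup>2 * N (jmx x0 G)"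
      using N_jmx(1)[OF G S L] by (intro mult_left_mono) (auto simp: d_def)
    moreover have "8 * \<Lambda> * N G * 1 \<le> 8 * \<Lambda> * N G * (\<Lambda> * d\<^sup>2)"
      using \<Lambda> N_nonneg[of G] by (intro mult_left_mono) (auto simp: d_def)
    ultimately have "8 * d\<^sup>2 * (\<Lambda>\<^sup>2 * N G) \<le> 4 * N (B G)"
      by (simp add: power2_eq_square algebra_simps)
    then show ?thesis
      using d by (simp add: k flip: d_def) (simp add: field_simps)
  qed
  have a': "N G \<le> k * N (B G)" if G: "good G" for G
  proof -
    have "1 * N G \<le> \<Lambda>\<^sup>2 * N G"
      using \<Lambda> N_nonneg[of G] by (intro mult_right_mono) auto
    then show ?thesis
      using a[OF G] by simp
  qed
  have b: "N (jdx G) \<le> k1 * N (B G)" if G: "good G" for G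
  proof -
    have "\<Lambda> * N G \<le> \<Lambda>\<^sup>2 * N G"
      using \<Lambda> N_nonneg[of G] by (intro mult_right_mono) (auto simp: power2_eq_square)
    then show ?thesis
      using a[OF G] N_jdx[OF G] by (simp add: k(2) algebra_simps)
  qed
  have c: "N (jdx (jdx G)) \<le> c2 * N (B (B G))" if G: "good G" for G
  proof -
    have g: "good (jdx G)" "good (B G)" "good (jmx x0 (jdx G))" "good (jdx (B G))"
      using G by (auto intro: good_intros smooth_jet_jmx)
    \<comment> \<open>The inner derivative is written as \<open>B G\<close> minus
      \<open>4 * \<Lambda> * (x - x0) * G\<close> before the outer one is applied. The factors
      \<open>\<Lambda>\<^sup>2\<close> that this creates in the norm are paid for by further factors
      \<open>B\<close>.\<close>
    have eq: "jdx (jdx G) = jlin 1 (jdx (B G)) (- 4 * \<Lambda>) (jlin 1 (jmx x0 (jdx G)) 1 G)"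
      by (subst (2) jdx_eq) (simp add: jdx_jlin jdx_jmx)
    have "N (jdx (jdx G)) \<le> 2 * N (jdx (B G)) + 32 * \<Lambda>\<^sup>2 * N (jlin 1 (jmx x0 (jdx G)) 1 G)"
      unfolding eq using N_jlin_le[OF g(4) smooth_jet_jlin[OF g(3) G], of 1 "- 4 * \<Lambda>" 1 1]
      by (simp add: power_mult_distrib)
    also have "\<dots> \<le> 2 * N (jdx (B G)) + 32 * \<Lambda>\<^sup>2 * (2 * N (jmx x0 (jdx G)) + 2 * N G)"
      using N_jlin_le[OF g(3) G, of 1 1] by (intro add_left_mono mult_left_mono) auto
    also have "\<dots> \<le> 2 * N (jdx (B G)) + 32 * \<Lambda>\<^sup>2 * (2 * (x0\<^sup>2 * (k1 * N (B G))) + 2 * N G)"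
      using order.trans[OF N_jmx(2)[OF g(1) S L] mult_left_mono[OF b[OF G]]]
      by (intro add_left_mono mult_left_mono add_right_mono) auto
    also have "\<dots> = 2 * N (jdx (B G)) + 64 * x0\<^sup>2 * k1 * (\<Lambda>\<^sup>2 * N (B G)) + 64 * (\<Lambda>\<^sup>2 * N G)"
      by (simp add: algebra_simps)
    also have "\<dots> \<le> 2 * (k1 * N (B (B G))) + 64 * x0\<^sup>2 * k1 * (k * N (B (B G))) + 64 * (k * (k * N (B (B G))))"
      using b[OF g(2)] a[OF g(2)] order.trans[OF a[OF G] mult_left_mono[OF a'[OF g(2)]]] kpos
      by (intro add_mono mult_left_mono) auto
    also have "\<dots> = c2 * N (B (B G))"
      by (simp add: k(3) algebra_simps power2_eq_square)
    finally show ?thesis .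
  qed
  have e: "N (jdx (jdx (jdx G))) \<le> c3 * N (B (B (B G)))" if G: "good G" for G
  proof -
    have g: "good (jdx G)" "good (B G)" "good (jmx x0 (jdx (jdx G)))" "good (jdx (jdx (B G)))"
      "good (B (B G))" "good (jdx (jdx G))"
      using G by (auto intro: good_intros smooth_jet_jmx)
    \<comment> \<open>The coefficient 2 is the binomial one from two derivatives of
      \<open>(x - x0) * G\<close>.\<close>
    have eq: "jdx (jdx (jdx G)) = jlin 1 (jdx (jdx (B G))) (- 4 * \<Lambda>) (jlin 1 (jmx x0 (jdx (jdx G))) 2 (jdx G))"
      by (subst (3) jdx_eq) (simp add: jdx_jlin jdx_jmx, simp add: jlin_def algebra_simps)
    have "N (jdx (jdx (jdx G))) \<le> 2 * N (jdx (jdx (B G)))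
        + 32 * \<Lambda>\<^sup>2 * N (jlin 1 (jmx x0 (jdx (jdx G))) 2 (jdx G))"
      unfolding eq using N_jlin_le[OF g(4) smooth_jet_jlin[OF g(3) g(1)], of 1 "- 4 * \<Lambda>" 1 2]
      by (simp add: power_mult_distrib)
    also have "\<dots> \<le> 2 * N (jdx (jdx (B G))) + 32 * \<Lambda>\<^sup>2 * (2 * N (jmx x0 (jdx (jdx G))) + 8 * N (jdx G))"
      using N_jlin_le[OF g(3) g(1), of 1 2] by (intro add_left_mono mult_left_mono) auto
    also have "\<dots> \<le> 2 * N (jdx (jdx (B G)))
        + 32 * \<Lambda>\<^sup>2 * (2 * (x0\<^sup>2 * (c2 * N (B (B G)))) + 8 * (k1 * N (B G)))"
      using order.trans[OF N_jmx(2)[OF g(6) S L] mult_left_mono[OF c[OF G]]] b[OF G]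
      by (intro add_left_mono mult_left_mono add_mono) auto
    also have "\<dots> = 2 * N (jdx (jdx (B G))) + 64 * x0\<^sup>2 * c2 * (\<Lambda>\<^sup>2 * N (B (B G))) + 256 * k1 * (\<Lambda>\<^sup>2 * N (B G))"
      by (simp add: algebra_simps)
    also have "\<dots> \<le> 2 * (c2 * N (B (B (B G)))) + 64 * x0\<^sup>2 * c2 * (k * N (B (B (B G))))
        + 256 * k1 * (k * (k * N (B (B (B G)))))"
      using c[OF g(2)] a[OF g(5)] order.trans[OF a[OF g(2)] mult_left_mono[OF a'[OF g(5)]]] kpos
      by (intro add_mono mult_left_mono) auto
    also have "\<dots> = c3 * N (B (B (B G)))"
      by (simp add: c3 algebra_simps power2_eq_square)
    finally show ?thesis .
  qed
  have g: "good (B F)" "good (B (B F))"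
    using F by (auto intro: good_intros)
  have p: "0 \<le> \<Lambda>" "0 \<le> \<Lambda> ^ n" for n
    using \<Lambda> by auto
  let ?X = "\<Lambda> * N (B (B (B F)))"
  \<comment> \<open>Each factor \<open>\<Lambda>\<^sup>2\<close> is exchanged for one more
    \<open>B\<close>, until every term is bounded by a multiple of \<open>?X\<close>.\<close>
  have 2: "\<Lambda> ^ 3 * N (B (B F)) \<le> k * ?X"
    using mult_left_mono[OF a[OF g(2)] p(1)] by (simp add: eval_nat_numeral mult_ac)
  have "\<Lambda> ^ 5 * N (B F) \<le> k * (\<Lambda> ^ 3 * N (B (B F)))"
    using mult_left_mono[OF a[OF g(1)] p(2)[of 3]] by (simp add: eval_nat_numeral mult_ac)
  also have "\<dots> \<le> k * (k * ?X)"
    using 2 kpos by (intro mult_left_mono) auto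
  finally have 1: "\<Lambda> ^ 5 * N (B F) \<le> k * (k * ?X)" .
  have "\<Lambda> ^ 7 * N F \<le> k * (\<Lambda> ^ 5 * N (B F))"
    using mult_left_mono[OF a[OF F] p(2)[of 5]] by (simp add: eval_nat_numeral mult_ac)
  also have "\<dots> \<le> k * (k * (k * ?X))"
    using 1 kpos by (intro mult_left_mono) auto
  finally have 0: "\<Lambda> ^ 7 * N F \<le> k ^ 3 * ?X"
    by (simp add: eval_nat_numeral mult_ac)
  have "\<Lambda> ^ 5 * N (jdx F) \<le> k1 * (\<Lambda> ^ 5 * N (B F))"
    using mult_left_mono[OF b[OF F] p(2)[of 5]] by (simp add: mult_ac)
  also have "\<dots> \<le> k1 * (k * (k * ?X))"
    using 1 kpos by (intro mult_left_mono) auto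
  finally have 3: "\<Lambda> ^ 5 * N (jdx F) \<le> k1 * k\<^sup>2 * ?X"
    by (simp add: eval_nat_numeral mult_ac)
  have "\<Lambda> ^ 3 * N (jdx (jdx F)) \<le> c2 * (\<Lambda> ^ 3 * N (B (B F)))"
    using mult_left_mono[OF c[OF F] p(2)[of 3]] by (simp add: mult_ac)
  also have "\<dots> \<le> c2 * (k * ?X)"
    using 2 kpos by (intro mult_left_mono) auto
  finally have 4: "\<Lambda> ^ 3 * N (jdx (jdx F)) \<le> c2 * k * ?X"
    by (simp add: mult_ac)
  have 5: "\<Lambda> * N (jdx (jdx (jdx F))) \<le> c3 * ?X"
    using mult_left_mono[OF e[OF F] p(1)] by (simp add: mult_ac)
  show ?thesis
    using 0 3 4 5 by (simp add: eval_nat_numeral ring_distribs)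
qed

text \<open>The bounds \<open>\<Lambda> \<ge> 1\<close> and
  \<open>\<Lambda> \<ge> \<beta> * \<gamma>\<^sup>2\<close> make the coefficient of
  \<open>N F\<close> in the lower bound nonnegative, so the operator controls
  \<open>\<Lambda> * N ((B ^^ 3) F)\<close>, and coercivity applies.\<close>

lemma N_operator_coercive:
  fixes L :: real
  assumes F: "good F" and S: "S \<subseteq> {z. 0 \<le> snd z \<and> snd z \<le> L}" and L: "L < x0" "0 < L"
    and "\<Lambda> \<ge> 1" "\<Lambda> * (x0 - L)\<^sup>2 \<ge> 1" and \<Lambda>: "\<Lambda> \<ge> \<beta> * \<gamma>\<^sup>2"
    and "k = 1 / (2 * (x0 - L)\<^sup>2)" "k1 = 1 + 4 * k" "c2 = 2 * k1 + 64 * x0\<^sup>2 * k1 * k + 64 * k\<^sup>2"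
    and "c3 = 2 * c2 + 64 * x0\<^sup>2 * c2 * k + 256 * k1 * k\<^sup>2"
  shows "\<Lambda> ^ 7 * N F + \<Lambda> ^ 5 * N (jdx F) + \<Lambda> ^ 3 * N ((jdx ^^ 2) F) + \<Lambda> * N ((jdx ^^ 3) F)
     \<le> (k ^ 3 + k1 * k\<^sup>2 + c2 * k + c3) * N (jlin \<gamma> (jdt F) 1 ((jdx ^^ 4) F))"
proof -
  have "\<Lambda> * (\<beta> * \<gamma>\<^sup>2) \<le> \<Lambda> * \<Lambda>"
    using assms by (intro mult_left_mono) auto
  also have "\<dots> \<le> \<Lambda> ^ 4"
    using assms power_increasing[of 2 4 \<Lambda>] by (simp add: power2_eq_square)
  finally have "4 * \<Lambda> * \<beta> * \<gamma>\<^sup>2 \<le> 4 * \<Lambda> ^ 4"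
    by (simp add: mult_ac)
  moreover have "0 \<le> \<Lambda> ^ 4"
    by simp
  ultimately have "4 * \<Lambda> * \<beta> * \<gamma>\<^sup>2 \<le> 6144 * \<Lambda> ^ 4"
    by linarith
  then have "0 \<le> (6144 * \<Lambda> ^ 4 - 4 * \<Lambda> * \<beta> * \<gamma>\<^sup>2) * N F"
    using N_nonneg[of F] by auto
  moreover have "0 \<le> \<Lambda> * N ((B ^^ 3) F)"
    using N_nonneg assms by auto
  ultimately have *: "\<Lambda> * N ((B ^^ 3) F) \<le> N (jlin \<gamma> (jdt F) 1 ((jdx ^^ 4) F))"
    using N_operator_ge[OF F, of \<gamma>] assms by linarith
  have "0 \<le> k" "0 \<le> k1" "0 \<le> c2" "0 \<le> c3"
    using assms(8-) L by simp_all
  then show ?thesis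
    using coercivity[OF assms(1-6,8-)] mult_left_mono[OF *, of "k ^ 3 + k1 * k\<^sup>2 + c2 * k + c3"]
    by simp
qed

end

subsection \<open>Mollification\<close>

text \<open>The mean value theorem bounds all difference quotients by \<open>g\<close>, so dominated
  convergence applies along every sequence of increments.\<close>

lemma has_real_derivative_integral:
  fixes k k' :: "real \<Rightarrow> 'a \<Rightarrow> real"
  assumes der: "\<And>t y. ((\<lambda>s. k s y) has_real_derivative k' t y) (at t)"
    and int: "\<And>t. integrable M (k t)" and g: "integrable M g"
    and bound: "\<And>t y. \<bar>k' t y\<bar> \<le> g y" and meas: "k' t \<in> borel_measurable M"
  shows "((\<lambda>s. integral\<^sup>L M (k s)) has_real_derivative integral\<^sup>L M (k' t)) (at t)"
  unfolding DERIV_def tendsto_at_iff_sequentially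
proof (intro allI impI)
  fix X :: "nat \<Rightarrow> real"
  assume X: "\<forall>i. X i \<in> UNIV - {0}" "X \<longlonglongrightarrow> 0"
  have "(\<lambda>i. \<integral>y. (k (t + X i) y - k t y) / X i \<partial>M) \<longlonglongrightarrow> integral\<^sup>L M (k' t)"
  proof (rule integral_dominated_convergence[OF meas _ g])
    show "(\<lambda>y. (k (t + X i) y - k t y) / X i) \<in> borel_measurable M" for i
      using int[of t] int[of "t + X i"] by (intro borel_measurable_divide borel_measurable_diff) auto
    show "AE y in M. (\<lambda>i. (k (t + X i) y - k t y) / X i) \<longlonglongrightarrow> k' t y"
    proof (rule always_eventually, rule allI)
      fix y
      have "((\<lambda>h. (k (t + h) y - k t y) / h) \<longlongrightarrow> k' t y) (at 0)"
        using der[of y t] by (simp add: DERIV_def)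
      then show "(\<lambda>i. (k (t + X i) y - k t y) / X i) \<longlonglongrightarrow> k' t y"
        using X unfolding tendsto_at_iff_sequentially by (auto simp: o_def)
    qed
    show "AE y in M. norm ((k (t + X i) y - k t y) / X i) \<le> g y" for i
    proof (rule always_eventually, rule allI)
      fix y
      have "norm (k (t + X i) y - k t y) \<le> g y * norm (t + X i - t)"
        by (rule field_differentiable_bound[where S = UNIV and f' = "\<lambda>s. k' s y"]) (auto simp: der bound)
      then show "norm ((k (t + X i) y - k t y) / X i) \<le> g y"
        using X(1) by (simp add: field_simps abs_divide)
    qed
  qed
  moreover have eq: "(\<integral>y. (k (t + X i) y - k t y) / X i \<partial>M)
      = (integral\<^sup>L M (k (t + X i)) - integral\<^sup>L M (k t)) / X i" for i
    using int by simp
  ultimately show "((\<lambda>h. (integral\<^sup>L M (k (t + h)) - integral\<^sup>L M (k t)) / h) \<circ> X) \<longlonglongrightarrow> integral\<^sup>L M (k' t)"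
    unfolding o_def eq by simp
qed

text \<open>For a mollifier \<open>b\<close>, this is the derivative \<open>\<partial>\<^sub>t\<^sup>i \<partial>\<^sub>x\<^sup>j\<close> of the mollification of \<open>f\<close>.\<close>

definition mconv :: "(nat \<Rightarrow> real \<Rightarrow> real) \<Rightarrow> nat \<Rightarrow> nat \<Rightarrow> (real \<times> real \<Rightarrow> real) \<Rightarrow> real \<times> real \<Rightarrow> real" where
  "mconv b i j f z = (\<integral>y. b i (fst z - fst y) * b j (snd z - snd y) * f y \<partial>lborel)"

lemma mollifier_DERIV: "mollifier \<delta> b \<Longrightarrow> (b n has_real_derivative b (Suc n) s) (at s)"
  and mollifier_zero: "mollifier \<delta> b \<Longrightarrow> \<bar>s\<bar> \<ge> \<delta> \<Longrightarrow> b n s = 0"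
  and mollifier_nonneg: "mollifier \<delta> b \<Longrightarrow> 0 \<le> b 0 s"
  by (auto simp: mollifier_def)

lemma mollifier_cont: "mollifier \<delta> b \<Longrightarrow> continuous_on A (b n)"
  using mollifier_DERIV DERIV_isCont by (blast intro: continuous_at_imp_continuous_on)

lemma mollifier_measurable : "mollifier \<delta> b \<Longrightarrow> b n \<in> borel_measurable borel"
  by (intro borel_measurable_continuous_onI mollifier_cont)

lemma mollifier_bounded:
  assumes "mollifier \<delta> b"
  obtains C where "C \<ge> 0" "\<And>s. \<bar>b n s\<bar> \<le> C"
proof -
  have "bounded (b n ` {-\<delta>..\<delta>})"
    by (intro compact_imp_bounded compact_continuous_image mollifier_cont[OF assms] compact_Icc)
  then obtain C where C: "\<And>s. s \<in> {-\<delta>..\<delta>} \<Longrightarrow> \<bar>b n s\<bar> \<le> C"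
    unfolding bounded_iff by (metis imageI real_norm_def)
  have "\<bar>b n s\<bar> \<le> max C 0" for s
    using C[of s] mollifier_zero[OF assms, of s n] by (cases "\<bar>s\<bar> < \<delta>") (auto simp: le_max_iff_disj abs_less_iff)
  then show ?thesis
    using that[of "max C 0"] by auto
qed

lemma mollifier_kernel_measurable:
  assumes "mollifier \<delta> b"
  shows "(\<lambda>y. b i (u - fst y) * b j (v - snd y)) \<in> borel_measurable borel"
  by (intro borel_measurable_continuous_onI continuous_intros
      continuous_on_compose2[OF mollifier_cont[OF assms, of UNIV]]) auto

lemma mconv_integrable:
  assumes b: "mollifier \<delta> b" and f: "integrable lborel f"
  shows "integrable lborel (\<lambda>y. b i (u - fst y) * b j (v - snd y) * f y)"
proof -
  obtain C D where C: "\<And>s. \<bar>b i s\<bar> \<le> C" and D: "\<And>s. \<bar>b j s\<bar> \<le> D"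
    using mollifier_bounded[OF b] by metis
  note [measurable] = mollifier_measurable[OF b] borel_measurable_integrable[OF f]
  have "\<bar>b i (u - fst y)\<bar> * \<bar>b j (v - snd y)\<bar> \<le> C * D" for y :: "real \<times> real"
    using C[of "u - fst y"] D[of "v - snd y"] by (intro mult_mono) auto
  then have bd: "\<bar>b i (u - fst y) * b j (v - snd y) * f y\<bar> \<le> (C * D) * \<bar>f y\<bar>" for y
    by (simp add: abs_mult mult_right_mono)
  show ?thesis
  proof (rule Bochner_Integration.integrable_bound[of lborel "\<lambda>y. (C * D) * \<bar>f y\<bar>"])
    show "AE y in lborel. norm (b i (u - fst y) * b j (v - snd y) * f y) \<le> norm (C * D * \<bar>f y\<bar>)"
      using bd by (intro AE_I2) (metis abs_ge_self order_trans real_norm_def)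
  next
    show "integrable lborel (\<lambda>y. (C * D) * \<bar>f y\<bar>)"
      using f by auto
    show "(\<lambda>y. b i (u - fst y) * b j (v - snd y) * f y) \<in> borel_measurable lborel"
      using borel_measurable_times[OF mollifier_kernel_measurable[OF b]] f by simp
  qed
qed

lemma mconv_measurable:
  assumes b: "mollifier \<delta> b" and f: "integrable lborel f"
  shows "(\<lambda>y. b i (u - fst y) * b j (v - snd y) * f y) \<in> borel_measurable borel"
  using borel_measurable_integrable[OF mconv_integrable[OF b f, of i u j v]] by simp

lemma mconv_cont:
  assumes b: "mollifier \<delta> b" and f: "integrable lborel f"
  shows "continuous_on UNIV (mconv b i j f)"
proof (rule continuous_at_imp_continuous_on, rule ballI)
  fix z
  obtain C D where C: "\<And>s. \<bar>b i s\<bar> \<le> C" and D: "\<And>s. \<bar>b j s\<bar> \<le> D"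
    using mollifier_bounded[OF b] by metis
  note [measurable] = mollifier_measurable[OF b] borel_measurable_integrable[OF f]
  have c: "isCont (b n) s" for n s
    using mollifier_DERIV[OF b] DERIV_isCont by blast
  have "\<bar>b i (u - fst y)\<bar> * \<bar>b j (v - snd y)\<bar> \<le> C * D" for y :: "real \<times> real" and u v
    using C[of "u - fst y"] D[of "v - snd y"] by (intro mult_mono) auto
  then have bd: "\<bar>b i (u - fst y) * b j (v - snd y) * f y\<bar> \<le> (C * D) * \<bar>f y\<bar>" for u v y
    by (simp add: abs_mult mult_right_mono)
  show "isCont (mconv b i j f) z"
    unfolding continuous_at_sequentially
  proof (intro allI impI)
    fix X :: "nat \<Rightarrow> real \<times> real"
    assume X: "X \<longlonglongrightarrow> z"
    show "(mconv b i j f \<circ> X) \<longlonglongrightarrow> mconv b i j f z"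
      unfolding mconv_def o_def
    proof (rule integral_dominated_convergence[of _ _ _ "\<lambda>y. (C * D) * \<bar>f y\<bar>"])
      show "AE y in lborel. (\<lambda>n. b i (fst (X n) - fst y) * b j (snd (X n) - snd y) * f y)
          \<longlonglongrightarrow> b i (fst z - fst y) * b j (snd z - snd y) * f y"
        using X by (intro always_eventually allI tendsto_intros isCont_tendsto_compose[OF c]) auto
    qed (use f bd mconv_measurable[OF b f] in simp_all)
  qed
qed

lemma mconv_DERIV_x:
  assumes b: "mollifier \<delta> b" and f: "integrable lborel f"
  shows "((\<lambda>x. mconv b i j f (t, x)) has_real_derivative mconv b i (Suc j) f (t, x)) (at x)"
proof -
  obtain C D where C: "\<And>s. \<bar>b i s\<bar> \<le> C" and D: "\<And>s. \<bar>b (Suc j) s\<bar> \<le> D"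
    using mollifier_bounded[OF b] by metis
  note [measurable] = mollifier_measurable[OF b] borel_measurable_integrable[OF f]
  have "\<bar>b i (u - fst y)\<bar> * \<bar>b (Suc j) (v - snd y)\<bar> \<le> C * D" for y :: "real \<times> real" and u v
    using C[of "u - fst y"] D[of "v - snd y"] by (intro mult_mono) auto
  then have bd: "\<bar>b i (u - fst y) * b (Suc j) (v - snd y) * f y\<bar> \<le> (C * D) * \<bar>f y\<bar>" for u v y
    by (simp add: abs_mult mult_right_mono)
  have d: "((\<lambda>x. b j (x - a)) has_real_derivative b (Suc j) (x - a)) (at x)" for x a
  proof -
    have "((\<lambda>x. x - a) has_real_derivative 1) (at x)"
      by (auto intro!: derivative_eq_intros)
    from DERIV_chain2[OF mollifier_DERIV[OF b] this] show ?thesis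
      by simp
  qed
  show ?thesis
    unfolding mconv_def fst_conv snd_conv
    by (rule has_real_derivative_integral[of _ _ _ "\<lambda>y. (C * D) * \<bar>f y\<bar>"])
      (use f in \<open>auto intro!: mconv_integrable[OF b f] mconv_measurable[OF b f] bd DERIV_cmult DERIV_cmult_right d\<close>)
qed

lemma mconv_DERIV_t:
  assumes b: "mollifier \<delta> b" and f: "integrable lborel f"
  shows "((\<lambda>t. mconv b i j f (t, x)) has_real_derivative mconv b (Suc i) j f (t, x)) (at t)"
proof -
  obtain C D where C: "\<And>s. \<bar>b (Suc i) s\<bar> \<le> C" and D: "\<And>s. \<bar>b j s\<bar> \<le> D"
    using mollifier_bounded[OF b] by metis
  note [measurable] = mollifier_measurable[OF b] borel_measurable_integrable[OF f]
  have "\<bar>b (Suc i) (u - fst y)\<bar> * \<bar>b j (v - snd y)\<bar> \<le> C * D" for y :: "real \<times> real" and u v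
    using C[of "u - fst y"] D[of "v - snd y"] by (intro mult_mono) auto
  then have bd: "\<bar>b (Suc i) (u - fst y) * b j (v - snd y) * f y\<bar> \<le> (C * D) * \<bar>f y\<bar>" for u v y
    by (simp add: abs_mult mult_right_mono)
  have d: "((\<lambda>x. b i (x - a)) has_real_derivative b (Suc i) (x - a)) (at x)" for x a
  proof -
    have "((\<lambda>x. x - a) has_real_derivative 1) (at x)"
      by (auto intro!: derivative_eq_intros)
    from DERIV_chain2[OF mollifier_DERIV[OF b] this] show ?thesis
      by simp
  qed
  show ?thesis
    unfolding mconv_def fst_conv snd_conv
    by (rule has_real_derivative_integral[of _ _ _ "\<lambda>y. (C * D) * \<bar>f y\<bar>"])
      (use f in \<open>auto intro!: mconv_integrable[OF b f] mconv_measurable[OF b f] bd DERIV_cmult DERIV_cmult_right d\<close>)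
qed

text \<open>The product kernel lives on a square of half side \<open>\<delta>\<close>, which the
  ball of radius \<open>2 * \<delta>\<close> contains. This is the origin of the radius
  \<open>2 * \<delta>\<close> in all later conditions.\<close>

lemma mollifier_kernel_zero:
  assumes b: "mollifier \<delta> b" and "dist z y \<ge> 2 * \<delta>"
  shows "b i (fst z - fst y) * b j (snd z - snd y) = 0"
proof -
  have "dist z y \<le> \<bar>fst z - fst y\<bar> + \<bar>snd z - snd y\<bar>"
    using norm_Pair_le[of "fst z - fst y" "snd z - snd y"]
    by (simp add: dist_norm flip: fst_diff snd_diff)
  then have "\<bar>fst z - fst y\<bar> \<ge> \<delta> \<or> \<bar>snd z - snd y\<bar> \<ge> \<delta>"
    using assms(2) by linarith
  then show ?thesis
    using mollifier_zero[OF b] by auto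
qed

lemma smooth_jet_mconv:
  assumes b: "mollifier \<delta> b" and f: "integrable lborel f"
    and zero: "\<And>y. y \<notin> K \<Longrightarrow> f y = 0" and S: "(\<Union>y\<in>K. cball y (2 * \<delta>)) \<subseteq> S"
  shows "smooth_jet S (\<lambda>i j. mconv b i j f)"
proof -
  have "mconv b i j f z = 0" if "z \<notin> S" for i j z
  proof -
    have *: "b i (fst z - fst y) * b j (snd z - snd y) * f y = 0" for y
    proof (cases "y \<in> K")
      case True
      then have "dist z y > 2 * \<delta>"
        using S that by (force simp: dist_commute)
      then show ?thesis
        using mollifier_kernel_zero[OF b, of z y i j] by auto
    qed (simp add: zero)
    then show ?thesis
      unfolding mconv_def * by simp
  qed
  then show ?thesis
    unfolding smooth_jet_def using mconv_cont[OF b f] mconv_DERIV_x[OF b f] mconv_DERIV_t[OF b f] by auto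
qed

text \<open>The kernel centred at \<open>z\<close> is itself an admissible test function when the
  ball around \<open>z\<close> fits into \<open>U\<close>; it is inserted into the weak
  formulation.\<close>

lemma mconv_weak_derivative:
  assumes b: "mollifier \<delta> b" and U: "cball z (2 * \<delta>) \<subseteq> U"
    and weak: "\<And>\<phi>. \<phi> \<in> test_functions U \<Longrightarrow>
      (\<integral>y. (pdt ^^ i) ((pdx ^^ j) \<phi>) y * f y \<partial>lborel) = (-1) ^ (i + j) * (\<integral>y. \<phi> y * g y \<partial>lborel)"
  shows "mconv b i j f z = mconv b 0 0 g z"
proof -
  \<comment> \<open>The signs compensate the chain rule for the reflected argument, so that
    \<open>p (Suc n)\<close> is the derivative of \<open>p n\<close>. In the end they cancel against
    the sign in the weak formulation.\<close>
  define p q where "p = (\<lambda>n s. (-1) ^ n * b n (fst z - s))" and "q = (\<lambda>n s. (-1) ^ n * b n (snd z - s))"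
  have d: "((\<lambda>s. b n (a - s)) has_real_derivative - b (Suc n) (a - s)) (at s)" for n a s
    using DERIV_chain2[where f = "b n" and g = "\<lambda>s. a - s", OF mollifier_DERIV[OF b], of "-1" s UNIV]
      DERIV_diff[OF DERIV_const DERIV_ident, of a s UNIV]
    by simp
  have p: "(p n has_real_derivative p (Suc n) s) (at s)" for n s
    unfolding p_def using DERIV_cmult[OF d, of "(-1) ^ n"] by simp
  have q: "(q n has_real_derivative q (Suc n) s) (at s)" for n s
    unfolding q_def using DERIV_cmult[OF d, of "(-1) ^ n"] by simp
  define \<phi> where "\<phi> = (\<lambda>(s, y). p 0 s * q 0 y)"
  have sub: "closure {y. \<phi> y \<noteq> 0} \<subseteq> cball z (2 * \<delta>)"
  proof (rule closure_minimal)
    show "{y. \<phi> y \<noteq> 0} \<subseteq> cball z (2 * \<delta>)"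
      using mollifier_kernel_zero[OF b, of z _ 0 0] by (force simp: \<phi>_def p_def q_def)
  qed auto
  have "compact (closure {y. \<phi> y \<noteq> 0})"
    using sub by (meson bounded_cball bounded_subset closed_closure compact_eq_bounded_closed)
  then have "\<phi> \<in> test_functions U"
    using sub U Ck_prod[of p q, OF p q] by (auto simp: test_functions_def \<phi>_def)
  note weak = weak[OF this, unfolded \<phi>_def iterated_pd_prod[of p q, OF p q]]
  have "(-1) ^ (i + j) * mconv b i j f z = (\<integral>y. (case y of (s, y) \<Rightarrow> p i s * q j y) * f y \<partial>lborel)"
    unfolding mconv_def by (subst integral_mult_right_zero[symmetric], intro Bochner_Integration.integral_cong)
      (auto simp: p_def q_def power_add)
  also have "\<dots> = (-1) ^ (i + j) * mconv b 0 0 g z"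
    unfolding weak mconv_def by (simp add: p_def q_def case_prod_beta')
  finally show ?thesis
    by simp
qed

section \<open>Mollification as a contraction in the mean square\<close>

lemma nn_integral_lborel_Pair:
  fixes F :: "real \<times> real \<Rightarrow> ennreal"
  assumes "F \<in> borel_measurable borel"
  shows "(\<integral>\<^sup>+ z. F z \<partial>lborel) = (\<integral>\<^sup>+ t. \<integral>\<^sup>+ x. F (t, x) \<partial>lborel \<partial>lborel)"
  using lborel.nn_integral_fst[of F lborel] assms by (simp add: lborel_prod)

lemma mollifier_nn_integral:
  assumes b: "mollifier \<delta> b" and "c = 1 \<or> c = -1"
  shows "(\<integral>\<^sup>+ s. ennreal (b 0 (a + c * s)) \<partial>lborel) = 1"
proof -
  note [measurable] = mollifier_measurable[OF b]
  have "1 = (\<integral>\<^sup>+ s. ennreal (b 0 s) \<partial>lborel)"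
    using b nn_integral_eq_integral[of lborel "b 0"] by (simp add: mollifier_def)
  also have "\<dots> = (\<integral>\<^sup>+ s. ennreal (b 0 (a + c * s)) \<partial>lborel)"
    using assms(2) by (subst nn_integral_real_affine[of _ c a]) (auto simp: ennreal_1)
  finally show ?thesis
    by simp
qed

text \<open>The case \<open>c = -1\<close> integrates over the argument of the mollified function,
  the case \<open>c = 1\<close> over the centre of the kernel.\<close>

lemma mollifier_kernel_nn_integral:
  assumes b: "mollifier \<delta> b" and c: "c = 1 \<or> c = -1"
  shows "(\<integral>\<^sup>+ y. ennreal (b 0 (u + c * fst y) * b 0 (v + c * snd y)) \<partial>lborel) = 1"
proof -
  note [measurable] = mollifier_measurable[OF b]
  have "(\<integral>\<^sup>+ y. ennreal (b 0 (u + c * fst y) * b 0 (v + c * snd y)) \<partial>lborel)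
      = (\<integral>\<^sup>+ t. \<integral>\<^sup>+ x. ennreal (b 0 (u + c * t)) * ennreal (b 0 (v + c * x)) \<partial>lborel \<partial>lborel)"
  proof (subst nn_integral_lborel_Pair)
    show "(\<lambda>y. ennreal (b 0 (u + c * fst y) * b 0 (v + c * snd y))) \<in> borel_measurable borel"
      by (intro measurable_compose[OF _ measurable_ennreal] borel_measurable_continuous_onI continuous_intros
          continuous_on_compose2[OF mollifier_cont[OF b, of UNIV]]) auto
  qed (simp add: ennreal_mult mollifier_nonneg[OF b])
  also have "\<dots> = 1"
    by (simp add: nn_integral_cmult mollifier_nn_integral[OF b c])
  finally show ?thesis .
qed

lemma mollifier_kernel_integral:
  assumes b: "mollifier \<delta> b"
  shows "has_bochner_integral lborel (\<lambda>y. b 0 (u - fst y) * b 0 (v - snd y)) 1"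
proof -
  show ?thesis
    using mollifier_kernel_nn_integral[OF b, of "-1" u v] mollifier_kernel_measurable[OF b]
    by (intro has_bochner_integral_nn_integral) (auto intro!: mult_nonneg_nonneg mollifier_nonneg[OF b])
qed

text \<open>Jensen's inequality for the probability density \<open>\<eta>\<close>, obtained from the
  nonnegativity of the variance.\<close>

lemma mconv_square_le:
  assumes b: "mollifier \<delta> b" and f: "integrable lborel f" and f2: "integrable lborel (\<lambda>y. (f y)\<^sup>2)"
  shows "(mconv b 0 0 f z)\<^sup>2 \<le> mconv b 0 0 (\<lambda>y. (f y)\<^sup>2) z"
proof -
  define m where "m = mconv b 0 0 f z"
  define \<eta> where "\<eta> = (\<lambda>y. b 0 (fst z - fst y) * b 0 (snd z - snd y))"
  have \<eta>: "integrable lborel \<eta>" "integral\<^sup>L lborel \<eta> = 1"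
    using mollifier_kernel_integral[OF b, of "fst z" "snd z"]
    by (auto simp: \<eta>_def has_bochner_integral_iff)
  have i: "integrable lborel (\<lambda>y. \<eta> y * f y)" "integrable lborel (\<lambda>y. \<eta> y * (f y)\<^sup>2)"
    unfolding \<eta>_def by (intro mconv_integrable[OF b] f f2)+
  have "0 \<le> (\<integral>y. \<eta> y * (f y - m)\<^sup>2 \<partial>lborel)"
    by (intro integral_nonneg_AE) (auto simp: \<eta>_def mollifier_nonneg[OF b])
  also have "\<dots> = (\<integral>y. \<eta> y * (f y)\<^sup>2 - 2 * m * (\<eta> y * f y) + m\<^sup>2 * \<eta> y \<partial>lborel)"
    by (intro Bochner_Integration.integral_cong refl) (simp add: power2_eq_square algebra_simps)
  also have "\<dots> = mconv b 0 0 (\<lambda>y. (f y)\<^sup>2) z - 2 * m * m + m\<^sup>2"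
    using i \<eta> by (simp add: mconv_def m_def flip: \<eta>_def) (simp add: \<eta>_def mult.assoc)
  finally show ?thesis
    by (simp add: m_def power2_eq_square)
qed

text \<open>Jensen's inequality is followed by an exchange of the integrals; the kernel has mass one
  also as a function of its centre.\<close>

lemma mconv_nn_contraction:
  assumes b: "mollifier \<delta> b" and f: "integrable lborel f" and f2: "integrable lborel (\<lambda>y. (f y)\<^sup>2)"
  shows "(\<integral>\<^sup>+ z. ennreal ((mconv b 0 0 f z)\<^sup>2) \<partial>lborel) \<le> (\<integral>\<^sup>+ z. ennreal ((f z)\<^sup>2) \<partial>lborel)"
proof -
  note [measurable] = mollifier_measurable[OF b] borel_measurable_integrable[OF f]
  let ?k = "\<lambda>z y. b 0 (fst z - fst y) * b 0 (snd z - snd y)"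
  have k: "?k z y \<ge> 0" for z y
    using mollifier_nonneg[OF b] by simp
  have "(\<integral>\<^sup>+ z. ennreal ((mconv b 0 0 f z)\<^sup>2) \<partial>lborel)
      \<le> (\<integral>\<^sup>+ z. ennreal (mconv b 0 0 (\<lambda>y. (f y)\<^sup>2) z) \<partial>lborel)"
    by (intro nn_integral_mono ennreal_leI mconv_square_le[OF b f f2])
  also have "\<dots> = (\<integral>\<^sup>+ z. \<integral>\<^sup>+ y. ennreal (?k z y * (f y)\<^sup>2) \<partial>lborel \<partial>lborel)"
    unfolding mconv_def using k
    by (intro nn_integral_cong nn_integral_eq_integral[symmetric] mconv_integrable[OF b f2])
      (auto intro: mult_nonneg_nonneg simp: mollifier_nonneg[OF b])
  also have "\<dots> = (\<integral>\<^sup>+ y. \<integral>\<^sup>+ z. ennreal (?k z y * (f y)\<^sup>2) \<partial>lborel \<partial>lborel)"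
  proof (rule lborel_pair.Fubini'[symmetric])
    have "continuous_on UNIV (\<lambda>(z, y). ?k z y)"
      unfolding case_prod_beta'
      by (intro continuous_intros continuous_on_compose2[OF mollifier_cont[OF b, of UNIV]]) auto
    then have [measurable]: "(\<lambda>(z, y). ?k z y) \<in> borel_measurable (lborel \<Otimes>\<^sub>M lborel)"
      unfolding lborel_prod by (simp add: borel_measurable_continuous_onI)
    have "(\<lambda>p. (case p of (z, y) \<Rightarrow> ?k z y) * (f (snd p))\<^sup>2) \<in> borel_measurable (lborel \<Otimes>\<^sub>M lborel)"
      by measurable
    then show "(\<lambda>(z, y). ennreal (?k z y * (f y)\<^sup>2)) \<in> borel_measurable (lborel \<Otimes>\<^sub>M lborel)"
      by (simp add: case_prod_beta')
  qed
  also have "\<dots> = (\<integral>\<^sup>+ y. ennreal ((f y)\<^sup>2) * (\<integral>\<^sup>+ z. ennreal (?k z y) \<partial>lborel) \<partial>lborel)"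
  proof (rule nn_integral_cong)
    fix y
    have "(\<lambda>z. ?k z y) \<in> borel_measurable borel"
      by (intro borel_measurable_continuous_onI continuous_intros
          continuous_on_compose2[OF mollifier_cont[OF b, of UNIV]]) auto
    then show "(\<integral>\<^sup>+ z. ennreal (?k z y * (f y)\<^sup>2) \<partial>lborel) = ennreal ((f y)\<^sup>2) * (\<integral>\<^sup>+ z. ennreal (?k z y) \<partial>lborel)"
      using k by (subst nn_integral_cmult[symmetric]) (simp_all add: ennreal_mult mult.commute)
  qed
  also have "\<dots> = (\<integral>\<^sup>+ y. ennreal ((f y)\<^sup>2) \<partial>lborel)"
  proof (rule nn_integral_cong)
    fix y
    show "ennreal ((f y)\<^sup>2) * (\<integral>\<^sup>+ z. ennreal (?k z y) \<partial>lborel) = ennreal ((f y)\<^sup>2)"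
      using mollifier_kernel_nn_integral[OF b, of 1 "- fst y" "- snd y"] by simp
  qed
  finally show ?thesis .
qed

lemma mconv_lin:
  assumes b: "mollifier \<delta> b" and f: "integrable lborel f" and g: "integrable lborel g"
  shows "mconv b i j (\<lambda>y. \<alpha> * f y + \<beta> * g y) z = \<alpha> * mconv b i j f z + \<beta> * mconv b i j g z"
proof -
  have "mconv b i j (\<lambda>y. \<alpha> * f y + \<beta> * g y) z =
     (\<integral>y. \<alpha> * (b i (fst z - fst y) * b j (snd z - snd y) * f y) + \<beta> * (b i (fst z - fst y) * b j (snd z - snd y) * g y) \<partial>lborel)"
    unfolding mconv_def by (intro Bochner_Integration.integral_cong refl) (simp add: algebra_simps)
  then show ?thesis
    using mconv_integrable[OF b f] mconv_integrable[OF b g] by (simp add: mconv_def)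
qed

text \<open>A mollification is an average over the ball of radius \<open>2 * \<delta>\<close> with
  weights of total mass one.\<close>

lemma mconv_near:
  assumes b: "mollifier \<delta> b" and g: "integrable lborel g"
    and near: "\<And>y. dist z y < 2 * \<delta> \<Longrightarrow> \<bar>g y - a\<bar> \<le> \<omega>"
  shows "\<bar>mconv b 0 0 g z - a\<bar> \<le> \<omega>"
proof -
  define \<eta> where "\<eta> = (\<lambda>y. b 0 (fst z - fst y) * b 0 (snd z - snd y))"
  have \<eta>: "integrable lborel \<eta>" "integral\<^sup>L lborel \<eta> = 1"
    using mollifier_kernel_integral[OF b, of "fst z" "snd z"]
    by (auto simp: \<eta>_def has_bochner_integral_iff)
  have \<eta>0: "\<eta> y \<ge> 0" for y
    using mollifier_nonneg[OF b] by (simp add: \<eta>_def)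
  have i: "integrable lborel (\<lambda>y. \<eta> y * g y)"
    unfolding \<eta>_def by (intro mconv_integrable[OF b] g)
  have "mconv b 0 0 g z - a = (\<integral>y. \<eta> y * g y - a * \<eta> y \<partial>lborel)"
    using i \<eta> by (simp add: mconv_def flip: \<eta>_def) (simp add: \<eta>_def)
  also have "\<bar>\<dots>\<bar> \<le> (\<integral>y. \<omega> * \<eta> y \<partial>lborel)"
  proof (rule integral_abs_bound_integral)
    fix y
    show "\<bar>\<eta> y * g y - a * \<eta> y\<bar> \<le> \<omega> * \<eta> y"
    proof (cases "dist z y < 2 * \<delta>")
      case True
      have "\<bar>\<eta> y * g y - a * \<eta> y\<bar> = \<bar>g y - a\<bar> * \<eta> y"
        using \<eta>0[of y] abs_mult[of "g y - a" "\<eta> y"] by (simp add: algebra_simps)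
      then show ?thesis
        using near[OF True] \<eta>0[of y] by (simp add: mult_right_mono)
    next
      case False
      then show ?thesis
        using mollifier_kernel_zero[OF b, of z y 0 0] by (auto simp: \<eta>_def)
    qed
  qed (use i \<eta> in auto)
  also have "\<dots> = \<omega>"
    using \<eta> by simp
  finally show ?thesis .
qed

section \<open>Mean-square convergence of mollifications\<close>

text \<open>Truncation first reduces to a bounded function. Continuous functions converging to
  \<open>f\<close> almost everywhere are truncated at the same height, and dominated convergence
  applies because \<open>U\<close> has finite measure.\<close>

lemma continuous_approx_L2:
  fixes f :: "real \<times> real \<Rightarrow> real"
  assumes f [measurable]: "f \<in> borel_measurable borel" and f2: "integrable lborel (\<lambda>z. (f z)\<^sup>2)"
    and U: "U \<in> sets borel" "emeasure lborel U < \<infinity>" and e: "e > 0"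
  obtains g M where "continuous_on UNIV g" "\<And>z. \<bar>g z\<bar> \<le> M"
    "(\<integral>z. indicator U z * (f z - g z)\<^sup>2 \<partial>lborel) \<le> e"
proof -
  note [measurable] = U(1)
  define cl :: "real \<Rightarrow> real \<Rightarrow> real" where "cl m s = max (- m) (min m s)" for m s
  have cl: "\<bar>cl m s\<bar> \<le> m" "\<bar>s - cl m s\<bar> \<le> \<bar>s\<bar>" if "m \<ge> 0" for m s
    using that by (auto simp: cl_def)
  have clc: "continuous_on A (cl m)" for m A
    unfolding cl_def by (intro continuous_intros)
  have [measurable]: "cl m \<in> borel_measurable borel" for m
    by (intro borel_measurable_continuous_onI clc)
  have "(\<lambda>n. \<integral>z. indicator U z * (f z - cl (real n) (f z))\<^sup>2 \<partial>lborel) \<longlonglongrightarrow> (\<integral>z. 0 \<partial>(lborel :: (real \<times> real) measure))"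
  proof (rule integral_dominated_convergence[OF _ _ f2])
    show "AE z in lborel. (\<lambda>n. indicator U z * (f z - cl (real n) (f z))\<^sup>2) \<longlonglongrightarrow> 0"
    proof (rule always_eventually, rule allI)
      fix z
      obtain n0 :: nat where "\<bar>f z\<bar> \<le> real n0"
        using real_arch_simple by blast
      then have "\<forall>\<^sub>F n in sequentially. indicator U z * (f z - cl (real n) (f z))\<^sup>2 = 0"
        by (intro eventually_sequentiallyI[of n0]) (auto simp: cl_def)
      then show "(\<lambda>n. indicator U z * (f z - cl (real n) (f z))\<^sup>2) \<longlonglongrightarrow> 0"
        by (rule tendsto_eventually)
    qed
    show "AE z in lborel. norm (indicator U z * (f z - cl (real n) (f z))\<^sup>2) \<le> (f z)\<^sup>2" for n
      using cl(2)[of "real n" "f _"] by (intro always_eventually allI) (auto simp: indicator_def abs_le_square_iff)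
  qed auto
  then have "\<forall>\<^sub>F n in sequentially. (\<integral>z. indicator U z * (f z - cl (real n) (f z))\<^sup>2 \<partial>lborel) < e / 4"
    using order_tendstoD(2)[of _ 0 sequentially "e / 4"] e by simp
  then obtain m where m: "(\<integral>z. indicator U z * (f z - cl (real m) (f z))\<^sup>2 \<partial>lborel) < e / 4"
    by (auto simp: eventually_sequentially)
  \<comment> \<open>Measurability in the sense of the gauge integral supplies continuous functions
    that converge to \<open>f\<close> off a negligible set.\<close>
  have "f measurable_on UNIV"
    by (rule lebesgue_measurable_imp_measurable_on_real) (use f in \<open>auto intro: measurable_completion\<close>)
  then obtain X g where X: "negligible X" and g: "\<And>n. continuous_on UNIV (g n)"
    and lim: "\<And>z. z \<notin> X \<Longrightarrow> (\<lambda>n. g n z) \<longlonglongrightarrow> f z"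
    unfolding measurable_on_def by auto
  have [measurable]: "g n \<in> borel_measurable borel" for n
    by (intro borel_measurable_continuous_onI g)
  have "AE z in lebesgue. z \<notin> X"
    using X by (simp add: negligible_iff_null_sets AE_not_in)
  then have AE: "AE z in lborel. (\<lambda>n. g n z) \<longlonglongrightarrow> f z"
    unfolding AE_completion_iff by eventually_elim (rule lim)
  have iU: "integrable lborel (indicator U :: real \<times> real \<Rightarrow> real)"
    using U by (simp add: less_top)
  have "(\<lambda>n. \<integral>z. indicator U z * (cl m (f z) - cl m (g n z))\<^sup>2 \<partial>lborel)
      \<longlonglongrightarrow> (\<integral>z. 0 \<partial>(lborel :: (real \<times> real) measure))"
  proof (rule integral_dominated_convergence[of _ _ _ "\<lambda>z. (2 * real m)\<^sup>2 * indicator U z"])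
    show "AE z in lborel. (\<lambda>n. indicator U z * (cl m (f z) - cl m (g n z))\<^sup>2) \<longlonglongrightarrow> 0"
      using AE
    proof eventually_elim
      case (elim z)
      have "isCont (cl m) (f z)"
        using clc[of UNIV m] by (simp add: continuous_on_eq_continuous_at)
      from isCont_tendsto_compose[OF this elim] show ?case
        by (auto intro!: tendsto_eq_intros)
    qed
    show "AE z in lborel. norm (indicator U z * (cl m (f z) - cl m (g n z))\<^sup>2) \<le> (2 * real m)\<^sup>2 * indicator U z" for n
    proof (rule always_eventually, rule allI)
      fix z
      have "\<bar>cl m (f z) - cl m (g n z)\<bar> \<le> \<bar>2 * real m\<bar>"
        using cl(1)[of m "f z"] cl(1)[of m "g n z"] by simp
      then show "norm (indicator U z * (cl m (f z) - cl m (g n z))\<^sup>2) \<le> (2 * real m)\<^sup>2 * indicator U z"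
        unfolding abs_le_square_iff by (simp add: indicator_def)
    qed
  qed (use iU in auto)
  then have "\<forall>\<^sub>F n in sequentially. (\<integral>z. indicator U z * (cl m (f z) - cl m (g n z))\<^sup>2 \<partial>lborel) < e / 4"
    using order_tendstoD(2)[of _ 0 sequentially "e / 4"] e by simp
  then obtain n where n: "(\<integral>z. indicator U z * (cl m (f z) - cl m (g n z))\<^sup>2 \<partial>lborel) < e / 4"
    by (auto simp: eventually_sequentially)
  define h where "h = (\<lambda>z. cl m (g n z))"
  have i1: "integrable lborel (\<lambda>z. indicator U z * (f z - cl m (f z))\<^sup>2)"
    by (rule Bochner_Integration.integrable_bound[OF f2])
      (use cl(2)[of "real m" "f _"] in \<open>auto simp: indicator_def abs_le_square_iff\<close>)
  have i2: "integrable lborel (\<lambda>z. indicator U z * (cl m (f z) - h z)\<^sup>2)"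
  proof (rule Bochner_Integration.integrable_bound[of _ "\<lambda>z. (2 * real m)\<^sup>2 * indicator U z"])
    have "\<bar>cl m (f z) - h z\<bar> \<le> \<bar>2 * real m\<bar>" for z
      using cl(1)[of m "f z"] cl(1)[of m "g n z"] by (simp add: h_def)
    then show "AE z in lborel. norm (indicator U z * (cl m (f z) - h z)\<^sup>2) \<le> norm ((2 * real m)\<^sup>2 * indicator U z :: real)"
      unfolding abs_le_square_iff by (simp add: indicator_def)
  qed (use iU in \<open>auto simp: h_def\<close>)
  have "(\<integral>z. indicator U z * (f z - h z)\<^sup>2 \<partial>lborel)
      \<le> (\<integral>z. 2 * (indicator U z * (f z - cl m (f z))\<^sup>2) + 2 * (indicator U z * (cl m (f z) - h z)\<^sup>2) \<partial>lborel)"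
  proof (rule integral_mono')
    fix z
    have "(f z - h z)\<^sup>2 \<le> 2 * (f z - cl m (f z))\<^sup>2 + 2 * (cl m (f z) - h z)\<^sup>2"
      using zero_le_power2[of "(f z - cl m (f z)) - (cl m (f z) - h z)"]
      by (simp add: power2_eq_square algebra_simps)
    then show "indicator U z * (f z - h z)\<^sup>2 \<le> 2 * (indicator U z * (f z - cl m (f z))\<^sup>2) + 2 * (indicator U z * (cl m (f z) - h z)\<^sup>2)"
      by (simp add: indicator_def)
  qed (use i1 i2 in auto)
  also have "\<dots> \<le> e"
    using i1 i2 m n by (simp add: h_def)
  finally have "(\<integral>z. indicator U z * (f z - h z)\<^sup>2 \<partial>lborel) \<le> e" .
  moreover have "continuous_on UNIV h"
    unfolding h_def by (rule continuous_on_compose2[OF clc g]) auto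
  moreover have "\<bar>h z\<bar> \<le> m" for z
    using cl(1)[of m] by (simp add: h_def)
  ultimately show ?thesis
    using that by blast
qed

lemma mconv_L2_contraction:
  assumes b: "mollifier \<delta> b" and f: "integrable lborel f" and f2: "integrable lborel (\<lambda>y. (f y)\<^sup>2)"
  shows "integrable lborel (\<lambda>z. (mconv b 0 0 f z)\<^sup>2)"
    and "(\<integral>z. (mconv b 0 0 f z)\<^sup>2 \<partial>lborel) \<le> (\<integral>z. (f z)\<^sup>2 \<partial>lborel)"
proof -
  have fin: "(\<integral>\<^sup>+ z. ennreal ((f z)\<^sup>2) \<partial>lborel) = ennreal (\<integral>z. (f z)\<^sup>2 \<partial>lborel)"
    using f2 by (intro nn_integral_eq_integral) auto
  note le = mconv_nn_contraction[OF assms]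
  have m: "(\<lambda>z. (mconv b 0 0 f z)\<^sup>2) \<in> borel_measurable lborel"
    using borel_measurable_continuous_onI[OF mconv_cont[OF b f]] by simp
  show int: "integrable lborel (\<lambda>z. (mconv b 0 0 f z)\<^sup>2)"
    using le m unfolding fin by (intro integrableI_bounded) (auto simp: le_less_trans)
  have "(\<integral>\<^sup>+ z. ennreal ((mconv b 0 0 f z)\<^sup>2) \<partial>lborel) = ennreal (\<integral>z. (mconv b 0 0 f z)\<^sup>2 \<partial>lborel)"
    using int by (intro nn_integral_eq_integral) auto
  then show "(\<integral>z. (mconv b 0 0 f z)\<^sup>2 \<partial>lborel) \<le> (\<integral>z. (f z)\<^sup>2 \<partial>lborel)"
    using le unfolding fin by (simp add: ennreal_le_iff)
qed

text \<open>On the set \<open>U\<close> of finite measure, the modulus is at most the square plus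
  one.\<close>

lemma square_integrable_imp_integrable:
  fixes f :: "real \<times> real \<Rightarrow> real"
  assumes "f \<in> borel_measurable borel" "integrable lborel (\<lambda>z. (f z)\<^sup>2)" "\<And>z. z \<notin> U \<Longrightarrow> f z = 0"
    and "U \<in> sets borel" "emeasure lborel U < \<infinity>"
  shows "integrable lborel f"
proof (rule Bochner_Integration.integrable_bound[of _ "\<lambda>z. (f z)\<^sup>2 + indicator U z"])
  show "integrable lborel (\<lambda>z. (f z)\<^sup>2 + indicator U z)"
    using assms by (simp add: less_top)
  have "\<bar>f z\<bar> \<le> (f z)\<^sup>2 + indicator U z" for z
  proof (cases "z \<in> U")
    case True
    have "2 * \<bar>f z\<bar> \<le> \<bar>f z\<bar>\<^sup>2 + 1"
      using zero_le_power2[of "\<bar>f z\<bar> - 1"] by (simp add: power2_diff)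
    then have "\<bar>f z\<bar> \<le> \<bar>f z\<bar>\<^sup>2 + 1"
      using abs_ge_zero[of "f z"] by linarith
    with True show ?thesis
      by simp
  qed (simp add: assms)
  then show "AE z in lborel. norm (f z) \<le> norm ((f z)\<^sup>2 + indicator U z)"
    by (intro AE_I2) (metis abs_ge_self order_trans real_norm_def)
qed (use assms in simp)

text \<open>The function is split as \<open>d + h\<close>. The part \<open>d\<close> is small in the
  mean square, and mollification does not enlarge it. The part \<open>h\<close> is continuous inside
  \<open>U\<close>, so its mollifications converge uniformly on \<open>K\<close>.\<close>

lemma mconv_L2_tendsto:
  fixes f :: "real \<times> real \<Rightarrow> real"
  assumes U: "open U" "bounded U" and K: "compact K" "K \<subseteq> U"
    and f [measurable]: "f \<in> borel_measurable borel" and f2: "integrable lborel (\<lambda>z. (f z)\<^sup>2)"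
    and zero: "\<And>z. z \<notin> U \<Longrightarrow> f z = 0"
    and b: "\<And>n. mollifier (\<delta> n) (b n)" and \<delta>: "\<delta> \<longlonglongrightarrow> 0"
  shows "(\<lambda>n. \<integral>z. indicator K z * (mconv (b n) 0 0 f z - f z)\<^sup>2 \<partial>lborel) \<longlonglongrightarrow> 0"
proof (rule order_tendstoI)
  fix a :: real assume "a < 0"
  have "0 \<le> (\<integral>z. indicator K z * (mconv (b n) 0 0 f z - f z)\<^sup>2 \<partial>lborel)" for n
    by (intro integral_nonneg_AE) auto
  with \<open>a < 0\<close> show "\<forall>\<^sub>F n in sequentially. a < (\<integral>z. indicator K z * (mconv (b n) 0 0 f z - f z)\<^sup>2 \<partial>lborel)"
    by (intro always_eventually) (auto intro: less_le_trans)
next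
  fix a :: real assume "0 < a"
  \<comment> \<open>Three contributions of at most \<open>3 * e\<close> each arise below, and
    \<open>9 * e < a\<close>.\<close>
  define e where "e = a / 10"
  have e: "e > 0" using \<open>0 < a\<close> by (simp add: e_def)
  have Um: "U \<in> sets borel" "emeasure lborel U < \<infinity>"
    using U emeasure_bounded_finite[of U] by auto
  note [measurable] = Um(1)
  have Km: "K \<in> sets lborel" "emeasure lborel K < \<infinity>"
    using K emeasure_compact_finite[of K] by (auto intro: borel_compact)
  have iU: "integrable lborel (indicator U :: real \<times> real \<Rightarrow> real)"
    using Um by (simp add: less_top)
  have iK: "integrable lborel (indicator K :: real \<times> real \<Rightarrow> real)"
    using Km by (simp add: less_top)
  obtain g M where g: "continuous_on UNIV g" and M: "\<And>z. \<bar>g z\<bar> \<le> M"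
    and fg: "(\<integral>z. indicator U z * (f z - g z)\<^sup>2 \<partial>lborel) \<le> e"
    using continuous_approx_L2[OF f f2 Um e] by blast
  have [measurable]: "g \<in> borel_measurable borel"
    by (rule borel_measurable_continuous_onI[OF g])
  define h d where "h = (\<lambda>z. indicator U z * g z)" and "d = (\<lambda>z. indicator U z * (f z - g z))"
  have M0: "M \<ge> 0"
    using M[of undefined] by linarith
  have fi: "integrable lborel f"
    by (rule square_integrable_imp_integrable[OF f f2 zero Um])
  have hi: "integrable lborel h"
    by (rule Bochner_Integration.integrable_bound[of _ "\<lambda>z. M * indicator U z"])
      (use iU M M0 in \<open>auto simp: h_def split: split_indicator\<close>)
  have fdh: "f = (\<lambda>z. 1 * d z + 1 * h z)"
    by (rule ext) (auto simp: d_def h_def indicator_def zero)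
  then have "d = (\<lambda>z. f z - h z)"
    by auto
  then have di: "integrable lborel d"
    using fi hi by simp
  have d2: "integrable lborel (\<lambda>z. (d z)\<^sup>2)"
  proof (rule Bochner_Integration.integrable_bound[of _ "\<lambda>z. 2 * (f z)\<^sup>2 + 2 * M\<^sup>2 * indicator U z"])
    have "(d z)\<^sup>2 \<le> 2 * (f z)\<^sup>2 + 2 * M\<^sup>2 * indicator U z" for z
    proof (cases "z \<in> U")
      case True
      have "(g z)\<^sup>2 \<le> M\<^sup>2"
        using M[of z] M0 by (simp add: abs_le_square_iff[symmetric])
      moreover have "(f z - g z)\<^sup>2 \<le> 2 * (f z)\<^sup>2 + 2 * (g z)\<^sup>2"
        using zero_le_power2[of "f z + g z"] by (simp add: power2_eq_square algebra_simps)
      ultimately show ?thesis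
        using True by (simp add: d_def)
    qed (simp add: d_def)
    then show "AE z in lborel. norm ((d z)\<^sup>2) \<le> norm (2 * (f z)\<^sup>2 + 2 * M\<^sup>2 * indicator U z)"
      by (intro AE_I2) (simp add: abs_of_nonneg)
  qed (use f2 Um in \<open>auto simp: d_def less_top\<close>)
  have "(d z)\<^sup>2 = indicator U z * (f z - g z)\<^sup>2" for z
    by (simp add: d_def indicator_def)
  then have de: "(\<integral>z. (d z)\<^sup>2 \<partial>lborel) \<le> e"
    using fg by simp
  obtain r where r: "r > 0" "(\<Union>z\<in>K. cball z r) \<subseteq> U"
    using compact_subset_open_imp_cball_epsilon_subset[OF K(1) U(1) K(2)] by blast
  \<comment> \<open>A compact neighbourhood of \<open>K\<close> inside \<open>U\<close>. There
    \<open>g\<close> is uniformly continuous and equal to \<open>h\<close>, so the jump of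
    \<open>h\<close> at the boundary of \<open>U\<close> is not seen.\<close>
  define S where "S = (\<Union>z\<in>K. cball z r)"
  have "compact S"
    unfolding S_def by (rule compact_minkowski_sum_cball[OF K(1)])
  then have uc: "uniformly_continuous_on S g"
    using g compact_uniformly_continuous continuous_on_subset by blast
  \<comment> \<open>Chosen so that \<open>\<omega>\<^sup>2\<close> times the measure of
    \<open>K\<close> is at most \<open>e\<close>; the summand 1 keeps the denominator positive when
    \<open>K\<close> is a null set.\<close>
  define \<omega> where "\<omega> = sqrt (e / (measure lborel K + 1))"
  have \<omega>: "\<omega> > 0" "\<omega>\<^sup>2 * measure lborel K \<le> e"
  proof -
    define q where "q = measure lborel K + 1"
    have q: "q > 0"
      unfolding q_def by (rule add_nonneg_pos[OF measure_nonneg zero_less_one])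
    then show "\<omega> > 0"
      using e by (simp add: \<omega>_def flip: q_def)
    have "\<omega>\<^sup>2 = e / q"
      using e q by (simp add: \<omega>_def flip: q_def)
    then have "\<omega>\<^sup>2 * q = e"
      using q by simp
    moreover have "\<omega>\<^sup>2 * measure lborel K \<le> \<omega>\<^sup>2 * q"
      by (intro mult_left_mono) (auto simp: q_def)
    ultimately show "\<omega>\<^sup>2 * measure lborel K \<le> e"
      by simp
  qed
  obtain \<eta> where \<eta>: "\<eta> > 0" "\<And>y z. y \<in> S \<Longrightarrow> z \<in> S \<Longrightarrow> dist y z < \<eta> \<Longrightarrow> dist (g y) (g z) < \<omega>"
    using uc \<omega>(1) unfolding uniformly_continuous_on_def by metis
  have "\<forall>\<^sub>F n in sequentially. \<delta> n < min r \<eta> / 2"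
    using \<delta> r \<eta> by (intro order_tendstoD(2)[of _ 0]) auto
  then show "\<forall>\<^sub>F n in sequentially. (\<integral>z. indicator K z * (mconv (b n) 0 0 f z - f z)\<^sup>2 \<partial>lborel) < a"
  proof eventually_elim
    case (elim n)
    have near: "\<bar>mconv (b n) 0 0 h z - g z\<bar> \<le> \<omega>" if z: "z \<in> K" for z
    proof (rule mconv_near[OF b hi])
      fix y assume y: "dist z y < 2 * \<delta> n"
      then have yS: "y \<in> S" "z \<in> S"
        using z elim r(1) unfolding S_def by (auto intro!: bexI[OF _ z])
      have "y \<in> U"
        using yS(1) r(2) unfolding S_def by blast
      then show "\<bar>h y - g z\<bar> \<le> \<omega>"
        using \<eta>(2)[OF yS] y elim by (auto simp: h_def dist_real_def dist_commute)
    qed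
    have "(\<integral>z. indicator K z * (mconv (b n) 0 0 f z - f z)\<^sup>2 \<partial>lborel)
      \<le> (\<integral>z. 3 * (mconv (b n) 0 0 d z)\<^sup>2 + 3 * \<omega>\<^sup>2 * indicator K z + 3 * (d z)\<^sup>2 \<partial>lborel)"
    proof (rule integral_mono')
      show "integrable lborel (\<lambda>z. 3 * (mconv (b n) 0 0 d z)\<^sup>2 + 3 * \<omega>\<^sup>2 * indicator K z + 3 * (d z)\<^sup>2)"
        using mconv_L2_contraction(1)[OF b di d2] d2 iK by simp
      show "indicator K z * (mconv (b n) 0 0 f z - f z)\<^sup>2
        \<le> 3 * (mconv (b n) 0 0 d z)\<^sup>2 + 3 * \<omega>\<^sup>2 * indicator K z + 3 * (d z)\<^sup>2" for z
      proof (cases "z \<in> K")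
        case True
        have "mconv (b n) 0 0 f z = mconv (b n) 0 0 d z + mconv (b n) 0 0 h z"
          by (subst fdh, subst mconv_lin[OF b di hi]) simp
        then have eq: "mconv (b n) 0 0 f z - f z = mconv (b n) 0 0 d z + (mconv (b n) 0 0 h z - g z) - d z"
          using True K(2) by (auto simp: d_def)
        have "(mconv (b n) 0 0 h z - g z)\<^sup>2 \<le> \<omega>\<^sup>2"
          using near[OF True] \<omega>(1) by (simp add: abs_le_square_iff[symmetric])
        moreover have "(p + q - s)\<^sup>2 \<le> 3 * p\<^sup>2 + 3 * q\<^sup>2 + 3 * s\<^sup>2" for p q s :: real
          using zero_le_power2[of "p - q"] zero_le_power2[of "p + s"] zero_le_power2[of "q + s"]
          by (simp add: power2_eq_square algebra_simps)
        ultimately show ?thesis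
          using True unfolding eq by (smt (verit) indicator_simps(1) mult_cancel_left1 mult_cancel_right1)
      qed simp
    qed auto
    also have "\<dots> = 3 * (\<integral>z. (mconv (b n) 0 0 d z)\<^sup>2 \<partial>lborel) + 3 * \<omega>\<^sup>2 * measure lborel K + 3 * (\<integral>z. (d z)\<^sup>2 \<partial>lborel)"
      using mconv_L2_contraction(1)[OF b di d2] d2 iK by simp
    also have "\<dots> \<le> 9 * e"
      using mconv_L2_contraction(2)[OF b di d2, of n] de \<omega>(2) by linarith
    also have "\<dots> < a"
      using \<open>0 < a\<close> by (simp add: e_def)
    finally show ?case .
  qed
qed

text \<open>By Young's inequality, the difference of the squares of \<open>v n\<close> and
  \<open>u\<close> is at most \<open>(1 + 1 / s)\<close> times the squared difference plus
  \<open>s\<close> times the square of \<open>u\<close>. First \<open>s\<close> is fixed to make the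
  last term small; then the squared difference tends to zero.\<close>

lemma weighted_square_tendsto:
  fixes u :: "real \<times> real \<Rightarrow> real"
  assumes K: "compact K" and W: "continuous_on UNIV W"
    and u [measurable]: "u \<in> borel_measurable borel" and u2: "integrable lborel (\<lambda>z. (u z)\<^sup>2)"
    and v: "\<And>n. continuous_on UNIV (v n)"
    and lim: "(\<lambda>n. \<integral>z. indicator K z * (v n z - u z)\<^sup>2 \<partial>lborel) \<longlonglongrightarrow> 0"
  shows "(\<lambda>n. \<integral>z. indicator K z * (W z * (v n z)\<^sup>2) \<partial>lborel) \<longlonglongrightarrow> (\<integral>z. indicator K z * (W z * (u z)\<^sup>2) \<partial>lborel)"
proof (rule LIMSEQ_I)
  fix e :: real assume e: "0 < e"
  have Km [measurable]: "K \<in> sets borel"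
    using K by (rule borel_compact)
  have "bounded (W ` K)"
    using K W by (intro compact_imp_bounded compact_continuous_image) (auto intro: continuous_on_subset)
  then obtain M0 where M0: "\<And>z. z \<in> K \<Longrightarrow> \<bar>W z\<bar> \<le> M0"
    unfolding bounded_iff by (metis imageI real_norm_def)
  define M where "M = \<bar>M0\<bar> + 1"
  have M: "M > 0" "\<And>z. z \<in> K \<Longrightarrow> \<bar>W z\<bar> \<le> M"
    using M0 by (force simp: M_def)+
  have [measurable]: "W \<in> borel_measurable borel" "v n \<in> borel_measurable borel" for n
    using W v by (auto intro: borel_measurable_continuous_onI)
  define A where "A = (\<integral>z. (u z)\<^sup>2 \<partial>lborel)"
  have A: "A \<ge> 0"
    unfolding A_def by (intro integral_nonneg_AE) auto
  \<comment> \<open>Half of \<open>e\<close> is reserved for the term with \<open>u\<close>; the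
    denominator \<open>A + 1\<close> is positive even when \<open>A = 0\<close>.\<close>
  define s where "s = e / (2 * M) / (A + 1)"
  have s: "s > 0" "M * s * A < e / 2"
  proof -
    show "s > 0"
      using e M(1) A by (simp add: s_def)
    have "M * s * A < M * s * (A + 1)"
      using \<open>s > 0\<close> M(1) by simp
    also have "s * (A + 1) = e / (2 * M)"
      using A by (simp add: s_def)
    then have "M * s * (A + 1) = e / 2"
      using M(1) by (simp add: mult.assoc)
    finally show "M * s * A < e / 2" .
  qed
  have c: "continuous_on K (v n)" "continuous_on K W" for n
    using v W by (blast intro: continuous_on_subset)+
  have iv: "integrable lborel (\<lambda>z. indicator K z * (v n z)\<^sup>2)" for n
    using borel_integrable_compact[OF K continuous_on_power[OF c(1)[of n], of 2]] by simp
  have iWv: "integrable lborel (\<lambda>z. indicator K z * (W z * (v n z)\<^sup>2))" for n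
    using borel_integrable_compact[OF K continuous_on_mult[OF c(2) continuous_on_power[OF c(1)[of n], of 2]]] by simp
  have id: "integrable lborel (\<lambda>z. indicator K z * (v n z - u z)\<^sup>2)" for n
  proof (rule Bochner_Integration.integrable_bound[of _ "\<lambda>z. 2 * (indicator K z * (v n z)\<^sup>2) + 2 * (u z)\<^sup>2"])
    have "indicator K z * (v n z - u z)\<^sup>2 \<le> 2 * (indicator K z * (v n z)\<^sup>2) + 2 * (u z)\<^sup>2" for z
      using zero_le_power2[of "v n z + u z"] by (simp add: indicator_def power2_eq_square algebra_simps)
    then show "AE z in lborel. norm (indicator K z * (v n z - u z)\<^sup>2) \<le> norm (2 * (indicator K z * (v n z)\<^sup>2) + 2 * (u z)\<^sup>2)"
      by (intro AE_I2) (simp add: abs_of_nonneg)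
  qed (use iv u2 in auto)
  have iWu: "integrable lborel (\<lambda>z. indicator K z * (W z * (u z)\<^sup>2))"
  proof (rule Bochner_Integration.integrable_bound[of _ "\<lambda>z. M * (u z)\<^sup>2"])
    have "\<bar>indicator K z * (W z * (u z)\<^sup>2)\<bar> \<le> M * (u z)\<^sup>2" for z
      using M(1) M(2)[of z] by (auto simp: indicator_def abs_mult intro!: mult_right_mono)
    then show "AE z in lborel. norm (indicator K z * (W z * (u z)\<^sup>2)) \<le> norm (M * (u z)\<^sup>2)"
      using M(1) by (intro AE_I2) (simp add: abs_of_nonneg)
  qed (use u2 in auto)
  \<comment> \<open>The bound on the squared difference that uses up the other half of
    \<open>e\<close>.\<close>
  define t where "t = e / (2 * (M * (1 + 1 / s)))"
  have t: "t > 0" "M * (1 + 1 / s) * t = e / 2"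
  proof -
    have "M * (1 + 1 / s) > 0"
      using M(1) s(1) by (intro mult_pos_pos add_pos_pos) auto
    moreover have "0 < e / (2 * p) \<and> p * (e / (2 * p)) = e / 2" if "p > 0" for p
      using e that by simp
    ultimately show "t > 0" "M * (1 + 1 / s) * t = e / 2"
      unfolding t_def by blast+
  qed
  obtain n0 where n0: "\<And>n. n \<ge> n0 \<Longrightarrow> (\<integral>z. indicator K z * (v n z - u z)\<^sup>2 \<partial>lborel) < t"
    using order_tendstoD(2)[OF lim t(1)] by (auto simp: eventually_sequentially)
  show "\<exists>n0. \<forall>n\<ge>n0. norm ((\<integral>z. indicator K z * (W z * (v n z)\<^sup>2) \<partial>lborel) - (\<integral>z. indicator K z * (W z * (u z)\<^sup>2) \<partial>lborel)) < e"
  proof (intro exI allI impI)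
    fix n assume n: "n \<ge> n0"
    have "(\<integral>z. indicator K z * (W z * (v n z)\<^sup>2) \<partial>lborel) - (\<integral>z. indicator K z * (W z * (u z)\<^sup>2) \<partial>lborel)
       = (\<integral>z. indicator K z * (W z * (v n z)\<^sup>2) - indicator K z * (W z * (u z)\<^sup>2) \<partial>lborel)"
      using iWv iWu by simp
    also have "\<bar>\<dots>\<bar> \<le> (\<integral>z. M * (1 + 1 / s) * (indicator K z * (v n z - u z)\<^sup>2) + M * s * (u z)\<^sup>2 \<partial>lborel)"
    proof (rule integral_abs_bound_integral)
      fix z
      let ?d = "v n z - u z"
      have "0 \<le> (s * \<bar>u z\<bar> - \<bar>?d\<bar>)\<^sup>2 / s"
        using s by simp
      also have "\<dots> = s * (u z)\<^sup>2 - 2 * \<bar>u z * ?d\<bar> + ?d\<^sup>2 / s"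
        using s by (simp add: power2_diff power_mult_distrib abs_mult) (simp add: field_simps power2_eq_square)
      finally have "2 * \<bar>u z * ?d\<bar> \<le> s * (u z)\<^sup>2 + ?d\<^sup>2 / s"
        by simp
      moreover have "(v n z)\<^sup>2 - (u z)\<^sup>2 = ?d\<^sup>2 + 2 * (u z * ?d)"
        by (simp add: power2_eq_square algebra_simps)
      moreover have "\<bar>?d\<^sup>2 + 2 * (u z * ?d)\<bar> \<le> ?d\<^sup>2 + 2 * \<bar>u z * ?d\<bar>"
        by (rule order_trans[OF abs_triangle_ineq]) simp
      ultimately have *: "\<bar>(v n z)\<^sup>2 - (u z)\<^sup>2\<bar> \<le> (1 + 1 / s) * ?d\<^sup>2 + s * (u z)\<^sup>2"
        by (simp add: algebra_simps)
      show "\<bar>indicator K z * (W z * (v n z)\<^sup>2) - indicator K z * (W z * (u z)\<^sup>2)\<bar>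
         \<le> M * (1 + 1 / s) * (indicator K z * (v n z - u z)\<^sup>2) + M * s * (u z)\<^sup>2"
      proof (cases "z \<in> K")
        case True
        have "\<bar>W z * (v n z)\<^sup>2 - W z * (u z)\<^sup>2\<bar> = \<bar>W z\<bar> * \<bar>(v n z)\<^sup>2 - (u z)\<^sup>2\<bar>"
          by (simp add: abs_mult flip: right_diff_distrib)
        also have "\<dots> \<le> M * ((1 + 1 / s) * ?d\<^sup>2 + s * (u z)\<^sup>2)"
          using M(1) M(2)[OF True] * by (intro mult_mono) auto
        finally show ?thesis
          using True by (simp add: algebra_simps)
      next
        case False
        then show ?thesis
          using M s by simp
      qed
    qed (use iWv iWu id u2 in auto)
    also have "\<dots> = M * (1 + 1 / s) * (\<integral>z. indicator K z * (v n z - u z)\<^sup>2 \<partial>lborel) + M * s * A"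
      using id u2 by (simp add: A_def)
    also have "\<dots> < M * (1 + 1 / s) * t + e / 2"
    proof (rule add_less_le_mono)
      show "M * (1 + 1 / s) * (\<integral>z. indicator K z * (v n z - u z)\<^sup>2 \<partial>lborel) < M * (1 + 1 / s) * t"
        using n0[OF n] M s by (intro mult_strict_left_mono) (auto intro!: mult_pos_pos add_pos_pos)
    qed (use s in auto)
    also have "\<dots> = e"
      unfolding t(2) by simp
    finally show "norm ((\<integral>z. indicator K z * (W z * (v n z)\<^sup>2) \<partial>lborel) - (\<integral>z. indicator K z * (W z * (u z)\<^sup>2) \<partial>lborel)) < e"
      by simp
  qed
qed

subsection \<open>The estimate for real functions with weak derivatives\<close>

text \<open>The integrals run over the whole plane. This agrees with integration over
  \<open>U\<close>, because test functions and their derivatives vanish off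
  \<open>U\<close>.\<close>

definition weak_on ::
  "(real \<times> real) set \<Rightarrow> nat \<Rightarrow> nat \<Rightarrow> (real \<times> real \<Rightarrow> real) \<Rightarrow> (real \<times> real \<Rightarrow> real) \<Rightarrow> bool" where
  "weak_on U i j f g \<longleftrightarrow> (\<forall>\<phi> \<in> test_functions U.
     (\<integral>y. (pdt ^^ i) ((pdx ^^ j) \<phi>) y * f y \<partial>lborel) = (-1) ^ (i + j) * (\<integral>y. \<phi> y * g y \<partial>lborel))"

text \<open>A Borel representative that is zero off \<open>U\<close> turns integrals over
  \<open>U\<close> for the completed measure into integrals over the plane for the Borel
  one.\<close>

definition L2_rep :: "(real \<times> real) set \<Rightarrow> (real \<times> real \<Rightarrow> real) \<Rightarrow> bool" where
  "L2_rep U f \<longleftrightarrow> f \<in> borel_measurable borel \<and> (\<forall>z. z \<notin> U \<longrightarrow> f z = 0) \<and> integrable lborel (\<lambda>z. (f z)\<^sup>2)"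

lemma L2_rep_integrable:
  assumes U: "open U" "bounded U" and f: "L2_rep U f"
  shows "integrable lborel f"
proof (rule square_integrable_imp_integrable)
  show "f z = 0" if "z \<notin> U" for z
    using f that unfolding L2_rep_def by blast
qed (use f U emeasure_bounded_finite[of U] in \<open>simp_all add: L2_rep_def\<close>)

lemma L2_rep_lin:
  assumes "L2_rep U f" "L2_rep U g"
  shows "L2_rep U (\<lambda>z. \<alpha> * f z + \<beta> * g z)"
proof -
  note [measurable] = assms[unfolded L2_rep_def, THEN conjunct1]
  have "integrable lborel (\<lambda>z. (\<alpha> * f z + \<beta> * g z)\<^sup>2)"
  proof (rule Bochner_Integration.integrable_bound[of _ "\<lambda>z. 2 * \<alpha>\<^sup>2 * (f z)\<^sup>2 + 2 * \<beta>\<^sup>2 * (g z)\<^sup>2"])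
    have "(\<alpha> * f z + \<beta> * g z)\<^sup>2 \<le> 2 * \<alpha>\<^sup>2 * (f z)\<^sup>2 + 2 * \<beta>\<^sup>2 * (g z)\<^sup>2" for z
      using zero_le_power2[of "\<alpha> * f z - \<beta> * g z"] by (simp add: power2_eq_square algebra_simps)
    then show "AE z in lborel. norm ((\<alpha> * f z + \<beta> * g z)\<^sup>2) \<le> norm (2 * \<alpha>\<^sup>2 * (f z)\<^sup>2 + 2 * \<beta>\<^sup>2 * (g z)\<^sup>2)"
      by (intro AE_I2) (simp add: abs_of_nonneg)
  qed (use assms in \<open>auto simp: L2_rep_def\<close>)
  then show ?thesis
    using assms by (auto simp: L2_rep_def)
qed

text \<open>A continuous weight is bounded on the compact closure of \<open>U\<close>.\<close>

lemma integrable_weight: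
  fixes f :: "real \<times> real \<Rightarrow> real"
  assumes U: "bounded U" and W: "continuous_on UNIV W" and f: "integrable lborel f"
    and zero: "\<And>z. z \<notin> U \<Longrightarrow> f z = 0"
  shows "integrable lborel (\<lambda>z. W z * f z)"
proof -
  have "bounded (W ` closure U)"
    using U W by (intro compact_imp_bounded compact_continuous_image) (auto intro: continuous_on_subset)
  then obtain M where M: "\<And>z. z \<in> closure U \<Longrightarrow> \<bar>W z\<bar> \<le> M"
    unfolding bounded_iff by (metis imageI real_norm_def)
  have [measurable]: "W \<in> borel_measurable borel"
    using W by (rule borel_measurable_continuous_onI)
  show ?thesis
  proof (rule Bochner_Integration.integrable_bound[of _ "\<lambda>z. M * f z"])
    have "\<bar>W z * f z\<bar> \<le> \<bar>M * f z\<bar>" for z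
    proof (cases "z \<in> U")
      case True
      then have "\<bar>W z\<bar> \<le> \<bar>M\<bar>"
        using M[of z] closure_subset[of U] by auto
      then show ?thesis
        by (simp add: abs_mult mult_right_mono)
    qed (simp add: zero)
    then show "AE z in lborel. norm (W z * f z) \<le> norm (M * f z)"
      by simp
  qed (use f in auto)
qed

text \<open>The factor from the coercivity estimate. It is built from \<open>x0\<close> and
  \<open>L\<close> alone and is therefore uniform in \<open>\<Lambda>\<close> and in the
  function.\<close>

definition carleman_const :: "real \<Rightarrow> real \<Rightarrow> real" where
  "carleman_const x0 L =
    (let k = 1 / (2 * (x0 - L)\<^sup>2); k1 = 1 + 4 * k; c2 = 2 * k1 + 64 * x0\<^sup>2 * k1 * k + 64 * k\<^sup>2;
         c3 = 2 * c2 + 64 * x0\<^sup>2 * c2 * k + 256 * k1 * k\<^sup>2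
     in k ^ 3 + k1 * k\<^sup>2 + c2 * k + c3)"

lemma carleman_const_pos:
  assumes "L < x0"
  shows "carleman_const x0 L > 0"
proof -
  define k where "k = 1 / (2 * (x0 - L)\<^sup>2)"
  have "k > 0"
    using assms by (simp add: k_def)
  then show ?thesis
    unfolding carleman_const_def Let_def k_def[symmetric] by (intro add_pos_nonneg) auto
qed

section \<open>Passage from mollifications to weak derivatives\<close>

text \<open>This describes one real component: \<open>f 0\<close> with its weak
  \<open>x\<close>-derivatives \<open>f j\<close> and its weak time derivative \<open>ft\<close>.
  Pointwise vanishing off \<open>K\<close> is assumed of \<open>f 0\<close>; the derivatives are
  assumed to vanish off \<open>U\<close>.\<close>

locale compactly_supported_derivatives =
  fixes U K :: "(real \<times> real) set" and f :: "nat \<Rightarrow> real \<times> real \<Rightarrow> real"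
    and ft :: "real \<times> real \<Rightarrow> real" and L x0 t0 \<beta> \<gamma> \<Lambda> :: real
  assumes U: "open U" "bounded U" "U \<subseteq> {z. 0 \<le> snd z \<and> snd z \<le> L}"
    and K: "compact K" "K \<subseteq> U" "\<And>z. z \<notin> K \<Longrightarrow> f 0 z = 0"
    and f: "\<And>j. j \<le> 4 \<Longrightarrow> L2_rep U (f j)" "L2_rep U ft"
    and weak: "\<And>j. j \<in> {1..4} \<Longrightarrow> weak_on U 0 j (f 0) (f j)" "weak_on U 1 0 (f 0) ft"
    and L: "L < x0" "0 < L"
    and \<Lambda>: "\<Lambda> \<ge> 1" "\<Lambda> * (x0 - L)\<^sup>2 \<ge> 1" "\<Lambda> \<ge> \<beta> * \<gamma>\<^sup>2"
begin

definition W :: "real \<times> real \<Rightarrow> real" where "W z = exp (2 * \<Lambda> * \<psi> x0 t0 \<beta> z)"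

definition fP :: "real \<times> real \<Rightarrow> real" where "fP = (\<lambda>z. \<gamma> * ft z + 1 * f 4 z)"

lemma W_cont: "continuous_on UNIV W"
  unfolding W_def \<psi>_def case_prod_beta' by (intro continuous_intros)

lemma fP: "L2_rep U fP"
  unfolding fP_def using f by (intro L2_rep_lin) auto

lemma integrable_L2_rep: "L2_rep U g \<Longrightarrow> integrable lborel g"
  by (rule L2_rep_integrable[OF U(1,2)])

lemma integrable_W_square: "L2_rep U g \<Longrightarrow> integrable lborel (\<lambda>z. W z * (g z)\<^sup>2)"
  by (rule integrable_weight[OF U(2) W_cont]) (auto simp: L2_rep_def)

text \<open>On \<open>S\<close>, the derivatives of the mollified \<open>f 0\<close> are the
  mollifications of the \<open>f j\<close>, since kernels centred in \<open>S\<close> fit into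
  \<open>U\<close>. Off \<open>S\<close> the jet vanishes. The smooth estimate thus becomes one for
  integrals over \<open>S\<close>.\<close>

lemma mollified_estimate:
  assumes b: "mollifier \<delta> b" and S: "compact S" "S \<subseteq> U"
    and near: "(\<Union>y\<in>K. cball y (2 * \<delta>)) \<subseteq> S" "(\<Union>z\<in>S. cball z (2 * \<delta>)) \<subseteq> U"
  defines "I \<equiv> \<lambda>g. \<integral>z. indicator S z * (W z * (mconv b 0 0 g z)\<^sup>2) \<partial>lborel"
  shows "\<Lambda> ^ 7 * I (f 0) + \<Lambda> ^ 5 * I (f 1) + \<Lambda> ^ 3 * I (f 2) + \<Lambda> * I (f 3) \<le> carleman_const x0 L * I fP"
proof -
  interpret cw: carleman_weight \<Lambda> x0 t0 \<beta> S
    by unfold_locales (rule S)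
  have W: "cw.W = W"
    by (simp add: cw.W_def W_def fun_eq_iff)
  define F where "F = (\<lambda>i j. mconv b i j (f 0))"
  have fi: "integrable lborel (f j)" if "j \<le> 4" for j
    using f(1)[OF that] by (rule integrable_L2_rep)
  have fti: "integrable lborel ft"
    using f(2) by (rule integrable_L2_rep)
  have F: "smooth_jet S F"
    unfolding F_def by (rule smooth_jet_mconv[OF b fi K(3) near(1)]) auto
  have zball: "cball z (2 * \<delta>) \<subseteq> U" if "z \<in> S" for z
    using near(2) that by blast
  have Fx: "F 0 j z = mconv b 0 0 (f j) z" if "z \<in> S" "j \<le> 4" for z j
  proof (cases "j = 0")
    case False
    then show ?thesis
      unfolding F_def using that weak(1)[of j]
      by (intro mconv_weak_derivative[OF b zball]) (auto simp: weak_on_def)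
  qed (simp add: F_def)
  have Ft: "F 1 0 z = mconv b 0 0 ft z" if "z \<in> S" for z
    unfolding F_def using that weak(2)
    by (intro mconv_weak_derivative[OF b zball]) (auto simp: weak_on_def)
  have N: "cw.ip G G = I g" if "\<And>z. z \<in> S \<Longrightarrow> G 0 0 z = mconv b 0 0 g z" "smooth_jet S G" for G g
    unfolding cw.ip_def I_def W
    by (intro Bochner_Integration.integral_cong refl)
      (use that smooth_jet_zero[OF that(2)] in \<open>auto simp: indicator_def power2_eq_square\<close>)
  have D: "(jdx ^^ k) F 0 0 = F 0 k" for k
  proof -
    have "(jdx ^^ k) F i j = F i (j + k)" for i j
      by (induction k arbitrary: j) (auto simp: jdx_def)
    then show ?thesis by simp
  qed
  have 1: "cw.ip F F = I (f 0)" "cw.ip (jdx F) (jdx F) = I (f 1)"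
    "cw.ip ((jdx ^^ 2) F) ((jdx ^^ 2) F) = I (f 2)" "cw.ip ((jdx ^^ 3) F) ((jdx ^^ 3) F) = I (f 3)"
    using F cw.good_funpow(1)[OF F] smooth_jet_jdx[OF F] D[of 1]
    by (intro N; simp add: D Fx)+
  have 2: "cw.ip (jlin \<gamma> (jdt F) 1 ((jdx ^^ 4) F)) (jlin \<gamma> (jdt F) 1 ((jdx ^^ 4) F)) = I fP"
  proof (rule N)
    show "smooth_jet S (jlin \<gamma> (jdt F) 1 ((jdx ^^ 4) F))"
      by (intro smooth_jet_jlin smooth_jet_jdt F cw.good_funpow(1))
    show "jlin \<gamma> (jdt F) 1 ((jdx ^^ 4) F) 0 0 z = mconv b 0 0 fP z" if "z \<in> S" for z
      unfolding fP_def mconv_lin[OF b fti fi[of 4, simplified]]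
      using Fx[OF that, of 4] Ft[OF that] by (simp add: jlin_def jdt_def D)
  qed
  have SL: "S \<subseteq> {z. 0 \<le> snd z \<and> snd z \<le> L}"
    using S U by auto
  show ?thesis
    using cw.N_operator_coercive[OF F SL L \<Lambda> refl refl refl refl]
    unfolding 1 2 carleman_const_def Let_def .
qed

text \<open>The mollification radius tends to zero. Eventually it is so small that the mollified
  function is supported in \<open>S\<close> and kernels centred in \<open>S\<close> stay in
  \<open>U\<close>.\<close>

lemma estimate_on_compact:
  assumes r: "r > 0" and S: "compact S" "S \<subseteq> U" "(\<Union>y\<in>K. cball y r) \<subseteq> S"
  defines "I \<equiv> \<lambda>g. \<integral>z. indicator S z * (W z * (g z)\<^sup>2) \<partial>lborel"
  shows "\<Lambda> ^ 7 * I (f 0) + \<Lambda> ^ 5 * I (f 1) + \<Lambda> ^ 3 * I (f 2) + \<Lambda> * I (f 3) \<le> carleman_const x0 L * I fP"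
proof -
  define \<delta> where "\<delta> = (\<lambda>n. inverse (real (Suc n)))"
  have "\<exists>b. mollifier (\<delta> n) b" for n
    using mollifier_exists[of "\<delta> n"] by (auto simp: \<delta>_def)
  then obtain b where b: "\<And>n. mollifier (\<delta> n) (b n)"
    by metis
  have \<delta>: "\<delta> \<longlonglongrightarrow> 0"
    unfolding \<delta>_def by (rule LIMSEQ_inverse_real_of_nat)
  obtain r' where r': "r' > 0" "(\<Union>z\<in>S. cball z r') \<subseteq> U"
    using compact_subset_open_imp_cball_epsilon_subset[OF S(1) U(1) S(2)] by blast
  define J where "J = (\<lambda>g n. \<integral>z. indicator S z * (W z * (mconv (b n) 0 0 g z)\<^sup>2) \<partial>lborel)"
  have lim: "J g \<longlonglongrightarrow> I g" if g: "L2_rep U g" for g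
    unfolding J_def I_def
  proof (rule weighted_square_tendsto[OF S(1) W_cont])
    show "(\<lambda>n. \<integral>z. indicator S z * (mconv (b n) 0 0 g z - g z)\<^sup>2 \<partial>lborel) \<longlonglongrightarrow> 0"
      by (rule mconv_L2_tendsto[OF U(1,2) S(1,2) _ _ _ b \<delta>]) (use g in \<open>auto simp: L2_rep_def\<close>)
    show "continuous_on UNIV (mconv (b n) 0 0 g)" for n
      by (rule mconv_cont[OF b integrable_L2_rep[OF g]])
  qed (use g in \<open>auto simp: L2_rep_def\<close>)
  show ?thesis
  proof (rule tendsto_le[OF trivial_limit_sequentially])
    show "(\<lambda>n. \<Lambda> ^ 7 * J (f 0) n + \<Lambda> ^ 5 * J (f 1) n + \<Lambda> ^ 3 * J (f 2) n + \<Lambda> * J (f 3) n)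
       \<longlonglongrightarrow> \<Lambda> ^ 7 * I (f 0) + \<Lambda> ^ 5 * I (f 1) + \<Lambda> ^ 3 * I (f 2) + \<Lambda> * I (f 3)"
      using f by (intro tendsto_intros lim) auto
    show "(\<lambda>n. carleman_const x0 L * J fP n) \<longlonglongrightarrow> carleman_const x0 L * I fP"
      by (intro tendsto_intros lim fP)
    have "\<forall>\<^sub>F n in sequentially. \<delta> n < min r r' / 2"
      using \<delta> r r' by (intro order_tendstoD(2)[of _ 0]) auto
    then show "\<forall>\<^sub>F n in sequentially. \<Lambda> ^ 7 * J (f 0) n + \<Lambda> ^ 5 * J (f 1) n + \<Lambda> ^ 3 * J (f 2) n + \<Lambda> * J (f 3) n
        \<le> carleman_const x0 L * J fP n"
    proof eventually_elim
      case (elim n)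
      have "(\<Union>y\<in>K. cball y (2 * \<delta> n)) \<subseteq> (\<Union>y\<in>K. cball y r)" "(\<Union>z\<in>S. cball z (2 * \<delta> n)) \<subseteq> (\<Union>z\<in>S. cball z r')"
        using elim by (intro UN_mono subset_refl subset_cball; simp)+
      then show ?case
        unfolding J_def using S(3) r'(2) by (intro mollified_estimate[OF b S(1,2)]) auto
    qed
  qed
qed

text \<open>Compact sets that eventually contain a neighbourhood of \<open>K\<close> exhaust
  \<open>U\<close>. On the right the integrals over them are bounded by the full one; on the left
  they converge by dominated convergence.\<close>

lemma estimate:
  "(\<integral>z. W z * (\<Lambda> ^ 7 * (f 0 z)\<^sup>2 + \<Lambda> ^ 5 * (f 1 z)\<^sup>2 + \<Lambda> ^ 3 * (f 2 z)\<^sup>2 + \<Lambda> * (f 3 z)\<^sup>2) \<partial>lborel)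
     \<le> carleman_const x0 L * (\<integral>z. W z * (fP z)\<^sup>2 \<partial>lborel)"
proof -
  define H where "H = (\<lambda>z. W z * (\<Lambda> ^ 7 * (f 0 z)\<^sup>2 + \<Lambda> ^ 5 * (f 1 z)\<^sup>2 + \<Lambda> ^ 3 * (f 2 z)\<^sup>2 + \<Lambda> * (f 3 z)\<^sup>2))"
  have Heq: "H z = \<Lambda> ^ 7 * (W z * (f 0 z)\<^sup>2) + \<Lambda> ^ 5 * (W z * (f 1 z)\<^sup>2) + \<Lambda> ^ 3 * (W z * (f 2 z)\<^sup>2)
      + \<Lambda> * (W z * (f 3 z)\<^sup>2)" for z
    by (simp add: H_def algebra_simps)
  have iW: "integrable lborel (\<lambda>z. W z * (f j z)\<^sup>2)" if "j \<le> 4" for j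
    by (rule integrable_W_square[OF f(1)[OF that]])
  have Hi: "integrable lborel H"
    using iW[of 0] iW[of 1] iW[of 2] iW[of 3] by (subst Heq[abs_def]) simp
  obtain r where r: "r > 0" "(\<Union>y\<in>K. cball y r) \<subseteq> U"
    using compact_subset_open_imp_cball_epsilon_subset[OF K(1) U(1) K(2)] by blast
  have Kr: "compact (\<Union>y\<in>K. cball y r)"
    by (rule compact_minkowski_sum_cball[OF K(1)])
  obtain C where C: "\<And>n. compact (C n)" "\<And>n. C n \<subseteq> U" "\<And>n. C n \<subseteq> interior (C (Suc n))" "\<Union>(range C) = U"
    "\<And>K. compact K \<Longrightarrow> K \<subseteq> U \<Longrightarrow> \<exists>N. \<forall>n\<ge>N. K \<subseteq> C n"
    using open_Union_compact_subsets[OF U(1)] by metis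
  have mono: "C m \<subseteq> C n" if "m \<le> n" for m n
    using lift_Suc_mono_le[of C m n] C(3) interior_subset that by blast
  have Cm [measurable]: "C n \<in> sets borel" for n
    using C(1) by (rule borel_compact)
  obtain n0 where n0: "\<And>n. n \<ge> n0 \<Longrightarrow> (\<Union>y\<in>K. cball y r) \<subseteq> C n"
    using C(5)[OF Kr r(2)] by blast
  have "(\<integral>z. indicator (C n) z * H z \<partial>lborel) \<le> carleman_const x0 L * (\<integral>z. W z * (fP z)\<^sup>2 \<partial>lborel)" if n: "n \<ge> n0" for n
  proof -
    have i: "integrable lborel (\<lambda>z. indicator (C n) z * (W z * (g z)\<^sup>2))" if "L2_rep U g" for g
      using integrable_mult_indicator[OF _ integrable_W_square[OF that], of "C n"] by simp
    have "(\<integral>z. indicator (C n) z * H z \<partial>lborel)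
      = (\<integral>z. \<Lambda> ^ 7 * (indicator (C n) z * (W z * (f 0 z)\<^sup>2)) + \<Lambda> ^ 5 * (indicator (C n) z * (W z * (f 1 z)\<^sup>2))
         + \<Lambda> ^ 3 * (indicator (C n) z * (W z * (f 2 z)\<^sup>2)) + \<Lambda> * (indicator (C n) z * (W z * (f 3 z)\<^sup>2)) \<partial>lborel)"
      by (intro Bochner_Integration.integral_cong refl) (simp add: Heq algebra_simps)
    also have "\<dots> \<le> carleman_const x0 L * (\<integral>z. indicator (C n) z * (W z * (fP z)\<^sup>2) \<partial>lborel)"
      using estimate_on_compact[OF r(1) C(1,2) n0[OF n]] i[OF f(1)[of 0]] i[OF f(1)[of 1]] i[OF f(1)[of 2]] i[OF f(1)[of 3]]
      by simp
    also have "\<dots> \<le> carleman_const x0 L * (\<integral>z. W z * (fP z)\<^sup>2 \<partial>lborel)"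
      using carleman_const_pos[OF L(1)] integrable_W_square[OF fP]
      by (intro mult_left_mono integral_mono') (auto simp: indicator_def W_def)
    finally show ?thesis .
  qed
  moreover have "(\<lambda>n. \<integral>z. indicator (C n) z * H z \<partial>lborel) \<longlonglongrightarrow> integral\<^sup>L lborel H"
  proof (rule integral_dominated_convergence[of _ _ _ "\<lambda>z. \<bar>H z\<bar>"])
    show "AE z in lborel. (\<lambda>n. indicator (C n) z * H z) \<longlonglongrightarrow> H z"
    proof (rule AE_I2, cases)
      fix z assume "z \<in> U"
      then obtain m where "z \<in> C m"
        using C(4) by auto
      then have "indicator (C n) z * H z = H z" if "n \<ge> m" for n
        using mono[OF that] by auto
      then show "(\<lambda>n. indicator (C n) z * H z) \<longlonglongrightarrow> H z"
        by (intro tendsto_eventually eventually_sequentiallyI[of m]) auto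
    next
      fix z assume "z \<notin> U"
      then have "f j z = 0" if "j \<le> 4" for j
        using f(1)[OF that] \<open>z \<notin> U\<close> unfolding L2_rep_def by blast
      then have "H z = 0"
        by (simp add: H_def)
      then show "(\<lambda>n. indicator (C n) z * H z) \<longlonglongrightarrow> H z"
        by simp
    qed
  qed (use Hi in \<open>auto simp: indicator_def\<close>)
  ultimately show ?thesis
    unfolding H_def[symmetric] by (intro LIMSEQ_le_const2) auto
qed

end

subsection \<open>Complex functions\<close>

lemma test_functions_iterated_cont:
  assumes "\<forall>k. Ck k \<phi>"
  shows "continuous_on UNIV ((pdt ^^ i) ((pdx ^^ j) \<phi>))"
proof -
  have t: "\<forall>k. Ck k (pdt h)" and x: "\<forall>k. Ck k (pdx h)" if "\<forall>k. Ck k h" for h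
    using that Ck.simps(2) by blast+
  have "\<forall>k. Ck k ((pdx ^^ j) \<phi>)"
    by (induction j) (use assms x in auto)
  then have "\<forall>k. Ck k ((pdt ^^ i) ((pdx ^^ j) \<phi>))"
    by (induction i) (use t in auto)
  then show ?thesis
    using Ck.simps(1) by blast
qed

text \<open>Measurability of \<open>g\<close> itself is recorded because integrals are later
  replaced along equality almost everywhere.\<close>

definition complex_parts_on ::
  "(real \<times> real) set \<Rightarrow> (real \<times> real \<Rightarrow> complex) \<Rightarrow> (real \<times> real \<Rightarrow> real) \<Rightarrow> (real \<times> real \<Rightarrow> real) \<Rightarrow> bool" where
  "complex_parts_on U g a b \<longleftrightarrow> set_borel_measurable lebesgue U g \<and> L2_rep U a \<and> L2_rep U b \<and>
     (AE z in lebesgue. z \<in> U \<longrightarrow> g z = Complex (a z) (b z))"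

text \<open>A Lebesgue measurable function agrees almost everywhere with a Borel one. The majorant
  \<open>G\<close> becomes the squared modulus when \<open>h\<close> is a real or imaginary
  part.\<close>

lemma L2_rep_exists:
  fixes h :: "real \<times> real \<Rightarrow> real"
  assumes U: "open U" and h: "(\<lambda>z. indicator U z * h z) \<in> borel_measurable lebesgue"
    and G: "integrable lebesgue G" "\<And>z. z \<in> U \<Longrightarrow> (h z)\<^sup>2 \<le> G z"
  obtains a where "L2_rep U a" "AE z in lebesgue. z \<in> U \<longrightarrow> h z = a z"
proof -
  obtain h' where h': "h' \<in> borel_measurable lborel" "AE z in lborel. indicator U z * h z = h' z"
    using completion_ex_borel_measurable_real[OF h] by auto
  define a where "a = (\<lambda>z. indicator U z * h' z)"
  have Um [measurable]: "U \<in> sets borel"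
    using U by simp
  have am: "a \<in> borel_measurable borel"
    using h'(1) unfolding a_def by simp
  have AE: "AE z in lebesgue. z \<in> U \<longrightarrow> h z = a z"
    unfolding AE_completion_iff using h'(2) by eventually_elim (auto simp: a_def)
  have "integrable lebesgue (\<lambda>z. (a z)\<^sup>2)"
  proof (rule Bochner_Integration.integrable_bound[OF G(1)])
    show "(\<lambda>z. (a z)\<^sup>2) \<in> borel_measurable lebesgue"
      using am by (intro borel_measurable_power measurable_completion) simp
    show "AE z in lebesgue. norm ((a z)\<^sup>2) \<le> norm (G z)"
      using AE
    proof eventually_elim
      case (elim z)
      show ?case
      proof (cases "z \<in> U")
        case True
        then show ?thesis
          using G(2)[OF True] elim by simp
      qed (simp add: a_def)
    qed
  qed
  then have "integrable lborel (\<lambda>z. (a z)\<^sup>2)"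
    using am by (subst (asm) integrable_completion) auto
  then have "L2_rep U a"
    using am by (auto simp: L2_rep_def a_def)
  with AE show ?thesis
    using that by blast
qed

lemma complex_parts_on_exists:
  assumes U: "open U" and g: "g \<in> L2 U"
  obtains a b where "complex_parts_on U g a b"
proof -
  have m: "(\<lambda>z. indicator U z *\<^sub>R g z) \<in> borel_measurable lebesgue"
    and i: "integrable lebesgue (\<lambda>z. indicator U z *\<^sub>R (cmod (g z))\<^sup>2)"
    using g unfolding L2_def set_borel_measurable_def set_integrable_def by blast+
  have "(\<lambda>z. indicator U z * Re (g z)) \<in> borel_measurable lebesgue"
    using measurable_compose[OF m borel_measurable_Re] by simp
  from L2_rep_exists[OF U this i] obtain a where
    a: "L2_rep U a" "AE z in lebesgue. z \<in> U \<longrightarrow> Re (g z) = a z"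
    by (auto simp: cmod_power2)
  have "(\<lambda>z. indicator U z * Im (g z)) \<in> borel_measurable lebesgue"
    using measurable_compose[OF m borel_measurable_Im] by simp
  from L2_rep_exists[OF U this i] obtain b where
    b: "L2_rep U b" "AE z in lebesgue. z \<in> U \<longrightarrow> Im (g z) = b z"
    by (auto simp: cmod_power2)
  have "AE z in lebesgue. z \<in> U \<longrightarrow> g z = Complex (a z) (b z)"
    using a(2) b(2) by eventually_elim (auto simp: complex_eq_iff)
  with a(1) b(1) g show ?thesis
    using that[of a b] by (auto simp: complex_parts_on_def L2_def)
qed

lemma set_lebesgue_integral_parts:
  assumes U: "open U" "bounded U" and g: "complex_parts_on U g a b" and \<theta>: "continuous_on UNIV \<theta>"
  shows "(LINT z:U|lebesgue. \<theta> z *\<^sub>R g z) = Complex (\<integral>z. \<theta> z * a z \<partial>lborel) (\<integral>z. \<theta> z * b z \<partial>lborel)"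
proof -
  have ab: "L2_rep U a" "L2_rep U b" and AE: "AE z in lebesgue. z \<in> U \<longrightarrow> g z = Complex (a z) (b z)"
    and m: "(\<lambda>z. indicator U z *\<^sub>R g z) \<in> borel_measurable lebesgue"
    using g by (auto simp: complex_parts_on_def set_borel_measurable_def)
  have i: "integrable lborel (\<lambda>z. \<theta> z * h z)" if "L2_rep U h" for h
  proof (rule integrable_weight[OF U(2) \<theta>])
    show "integrable lborel h"
      by (rule L2_rep_integrable[OF U that])
  qed (use that in \<open>auto simp: L2_rep_def\<close>)
  define H where "H = (\<lambda>z. complex_of_real (\<theta> z * a z) + \<i> * complex_of_real (\<theta> z * b z))"
  have [measurable]: "\<theta> \<in> borel_measurable borel"
    using \<theta> by (rule borel_measurable_continuous_onI)
  have Hi: "integrable lborel H" "integral\<^sup>L lborel H = Complex (\<integral>z. \<theta> z * a z \<partial>lborel) (\<integral>z. \<theta> z * b z \<partial>lborel)"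
    unfolding H_def using i[OF ab(1)] i[OF ab(2)]
    by (auto simp: complex_eq_iff simp del: of_real_mult)
  have "(LINT z:U|lebesgue. \<theta> z *\<^sub>R g z) = integral\<^sup>L lebesgue H"
    unfolding set_lebesgue_integral_def
  proof (rule integral_cong_AE)
    have "(\<lambda>z. \<theta> z *\<^sub>R (indicator U z *\<^sub>R g z)) \<in> borel_measurable lebesgue"
      by (intro borel_measurable_scaleR m measurable_completion) simp
    then show "(\<lambda>z. indicator U z *\<^sub>R \<theta> z *\<^sub>R g z) \<in> borel_measurable lebesgue"
      by (simp add: mult.commute)
    show "H \<in> borel_measurable lebesgue"
      using Hi(1) by (intro measurable_completion) auto
    show "AE z in lebesgue. indicator U z *\<^sub>R \<theta> z *\<^sub>R g z = H z"
      using AE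
    proof eventually_elim
      case (elim z)
      show ?case
      proof (cases "z \<in> U")
        case False
        then have "a z = 0" "b z = 0"
          using ab unfolding L2_rep_def by blast+
        then show ?thesis
          using False by (simp add: H_def)
      qed (use elim in \<open>auto simp: H_def complex_eq_iff\<close>)
    qed
  qed
  also have "\<dots> = integral\<^sup>L lborel H"
    using Hi(1) by (intro integral_completion) auto
  finally show ?thesis
    using Hi(2) by simp
qed

text \<open>Test functions are real-valued, so the complex identity separates into real and
  imaginary parts.\<close>

lemma weak_on_parts:
  assumes U: "open U" "bounded U" and w: "has_weak_pd U i j v g"
    and v: "complex_parts_on U v a b" and g: "complex_parts_on U g a' b'"
  shows "weak_on U i j a a'" "weak_on U i j b b'"
proof -
  have *: "(\<integral>y. (pdt ^^ i) ((pdx ^^ j) \<phi>) y * a y \<partial>lborel) = (-1) ^ (i + j) * (\<integral>y. \<phi> y * a' y \<partial>lborel) \<and>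
     (\<integral>y. (pdt ^^ i) ((pdx ^^ j) \<phi>) y * b y \<partial>lborel) = (-1) ^ (i + j) * (\<integral>y. \<phi> y * b' y \<partial>lborel)"
    if \<phi>: "\<phi> \<in> test_functions U" for \<phi>
  proof -
    have C: "\<forall>k. Ck k \<phi>"
      using \<phi> by (simp add: test_functions_def)
    have eq: "(LINT z:U|lebesgue. (pdt ^^ i) ((pdx ^^ j) \<phi>) z *\<^sub>R v z) = (-1) ^ (i + j) * (LINT z:U|lebesgue. \<phi> z *\<^sub>R g z)"
      using w \<phi> unfolding has_weak_pd_def by blast
    have s: "(-1) ^ n * Complex p q = Complex ((-1) ^ n * p) ((-1) ^ n * q)" for n p q
      by (cases "even n") (auto simp: complex_eq_iff)
    show ?thesis
      using eq unfolding set_lebesgue_integral_parts[OF U v test_functions_iterated_cont[OF C]]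
        set_lebesgue_integral_parts[OF U g test_functions_iterated_cont[OF C, of 0 0, simplified]] s
      by simp
  qed
  then show "weak_on U i j a a'" "weak_on U i j b b'"
    unfolding weak_on_def by blast+
qed

lemma complex_parts_on_lin:
  assumes "complex_parts_on U g a b" "complex_parts_on U g' a' b'"
  shows "complex_parts_on U (\<lambda>z. of_real \<gamma> * g z + g' z) (\<lambda>z. \<gamma> * a z + 1 * a' z) (\<lambda>z. \<gamma> * b z + 1 * b' z)"
  unfolding complex_parts_on_def
proof (intro conjI)
  have "(\<lambda>z. of_real \<gamma> * (indicator U z *\<^sub>R g z) + indicator U z *\<^sub>R g' z) \<in> borel_measurable lebesgue"
    using assms by (intro borel_measurable_add borel_measurable_times borel_measurable_const)
      (auto simp: complex_parts_on_def set_borel_measurable_def)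
  then show "set_borel_measurable lebesgue U (\<lambda>z. of_real \<gamma> * g z + g' z)"
    by (simp add: set_borel_measurable_def scaleR_add_right)
  have "AE z in lebesgue. z \<in> U \<longrightarrow> g z = Complex (a z) (b z)" "AE z in lebesgue. z \<in> U \<longrightarrow> g' z = Complex (a' z) (b' z)"
    using assms by (auto simp: complex_parts_on_def)
  then show "AE z in lebesgue. z \<in> U \<longrightarrow> of_real \<gamma> * g z + g' z = Complex (\<gamma> * a z + 1 * a' z) (\<gamma> * b z + 1 * b' z)"
    by eventually_elim (auto simp: complex_eq_iff)
qed (use assms in \<open>unfold complex_parts_on_def, blast intro: L2_rep_lin\<close>)+

text \<open>Vanishing almost everywhere off \<open>K\<close> becomes pointwise vanishing of the
  representatives, the form in which the estimate for real functions asks for it.\<close>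

lemma complex_parts_on_cutoff:
  assumes g: "complex_parts_on U g a b" and K: "compact K" and zero: "AE z in lebesgue. z \<in> U - K \<longrightarrow> g z = 0"
  shows "complex_parts_on U g (\<lambda>z. indicator K z * a z) (\<lambda>z. indicator K z * b z)"
proof -
  have [measurable]: "K \<in> sets borel"
    using K by (rule borel_compact)
  have *: "L2_rep U (\<lambda>z. indicator K z * h z)" if h: "L2_rep U h" for h
  proof -
    have "(\<lambda>z. (indicator K z * h z)\<^sup>2) = (\<lambda>z. indicator K z *\<^sub>R (h z)\<^sup>2)"
      by (auto simp: indicator_def)
    moreover have "integrable lborel (\<lambda>z. indicator K z *\<^sub>R (h z)\<^sup>2)"
      using h by (intro integrable_mult_indicator) (auto simp: L2_rep_def)
    ultimately show ?thesis
      using h by (auto simp: L2_rep_def)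
  qed
  have "AE z in lebesgue. z \<in> U \<longrightarrow> g z = Complex (a z) (b z)"
    using g by (simp add: complex_parts_on_def)
  with zero have "AE z in lebesgue. z \<in> U \<longrightarrow> g z = Complex (indicator K z * a z) (indicator K z * b z)"
    by eventually_elim (auto simp: indicator_def complex_eq_iff)
  with g * show ?thesis
    by (auto simp: complex_parts_on_def)
qed

text \<open>The complement of the support may be a union of uncountably many open sets. The Lindelof
  property leaves countably many of them, and the exceptional null sets then add up to a null
  set.\<close>

lemma AE_zero_outside_supp: "AE z in lebesgue. z \<in> U - supp U v \<longrightarrow> v z = 0"
proof -
  define \<F> where "\<F> = {W. open W \<and> (AE z in lebesgue. z \<in> W \<inter> U \<longrightarrow> v z = 0)}"
  obtain \<F>' where F: "\<F>' \<subseteq> \<F>" "countable \<F>'" "\<Union>\<F>' = \<Union>\<F>"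
    using Lindelof[of \<F>] by (auto simp: \<F>_def)
  have "AE z in lebesgue. \<forall>W\<in>\<F>'. z \<in> W \<inter> U \<longrightarrow> v z = 0"
    using F(1,2) by (subst AE_ball_countable) (auto simp: \<F>_def)
  then show ?thesis
  proof eventually_elim
    case (elim z)
    have "- supp U v = \<Union>\<F>'"
      unfolding F(3) by (simp add: supp_def \<F>_def)
    then show ?case
      using elim by auto
  qed
qed

text \<open>The squared modulus splits into the squares of both parts. The finite sum lets one
  statement serve the four terms on the left of the estimate and the single term on its
  right.\<close>

lemma set_lebesgue_integral_weighted_squares:
  fixes n :: nat and W :: "real \<times> real \<Rightarrow> real"
  assumes U: "open U" "bounded U" and W: "continuous_on UNIV W" and g: "\<And>j. j < n \<Longrightarrow> complex_parts_on U (g j) (a j) (b j)"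
  shows "(LINT z:U|lebesgue. W z * (\<Sum>j<n. c j * (cmod (g j z))\<^sup>2))
     = (\<integral>z. W z * (\<Sum>j<n. c j * (a j z)\<^sup>2) \<partial>lborel) + (\<integral>z. W z * (\<Sum>j<n. c j * (b j z)\<^sup>2) \<partial>lborel)"
proof -
  define A where "A = (\<lambda>z. W z * (\<Sum>j<n. c j * (a j z)\<^sup>2))"
  define B where "B = (\<lambda>z. W z * (\<Sum>j<n. c j * (b j z)\<^sup>2))"
  have [measurable]: "W \<in> borel_measurable borel"
    using W by (rule borel_measurable_continuous_onI)
  have ab: "L2_rep U (a j)" "L2_rep U (b j)" and AE: "AE z in lebesgue. z \<in> U \<longrightarrow> g j z = Complex (a j z) (b j z)"
    and m: "(\<lambda>z. indicator U z *\<^sub>R g j z) \<in> borel_measurable lebesgue" if "j < n" for j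
    using g[OF that] by (auto simp: complex_parts_on_def set_borel_measurable_def)
  have i: "integrable lborel (\<lambda>z. W z * (\<Sum>j<n. c j * (h j z)\<^sup>2))" if h: "\<And>j. j < n \<Longrightarrow> L2_rep U (h j)" for h
    using h by (intro integrable_weight[OF U(2) W] Bochner_Integration.integrable_sum)
      (auto simp: L2_rep_def intro!: sum.neutral)
  have AB: "integrable lborel A" "integrable lborel B"
    unfolding A_def B_def using ab by (auto intro: i)
  have "(LINT z:U|lebesgue. W z * (\<Sum>j<n. c j * (cmod (g j z))\<^sup>2)) = integral\<^sup>L lebesgue (\<lambda>z. A z + B z)"
    unfolding set_lebesgue_integral_def
  proof (rule integral_cong_AE)
    have "(\<lambda>z. W z * (\<Sum>j<n. c j * (cmod (indicator U z *\<^sub>R g j z))\<^sup>2)) \<in> borel_measurable lebesgue"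
      using W measurable_compose[OF m borel_measurable_norm]
      by (intro borel_measurable_times borel_measurable_sum borel_measurable_const borel_measurable_power
          measurable_completion[of W lborel]) (auto intro: borel_measurable_continuous_onI)
    moreover have "(\<lambda>z. W z * (\<Sum>j<n. c j * (cmod (indicator U z *\<^sub>R g j z))\<^sup>2))
      = (\<lambda>z. indicator U z *\<^sub>R (W z * (\<Sum>j<n. c j * (cmod (g j z))\<^sup>2)))"
      by (rule ext) (simp add: indicator_def)
    ultimately show "(\<lambda>z. indicator U z *\<^sub>R (W z * (\<Sum>j<n. c j * (cmod (g j z))\<^sup>2))) \<in> borel_measurable lebesgue"
      by simp
    show "(\<lambda>z. A z + B z) \<in> borel_measurable lebesgue"
      using AB by (intro measurable_completion) auto
    have "AE z in lebesgue. \<forall>j\<in>{..<n}. z \<in> U \<longrightarrow> g j z = Complex (a j z) (b j z)"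
      using AE by (subst AE_ball_countable) auto
    then show "AE z in lebesgue. indicator U z *\<^sub>R (W z * (\<Sum>j<n. c j * (cmod (g j z))\<^sup>2)) = A z + B z"
    proof eventually_elim
      case (elim z)
      show ?case
      proof (cases "z \<in> U")
        case True
        then have "(\<Sum>j<n. c j * (cmod (g j z))\<^sup>2) = (\<Sum>j<n. c j * (a j z)\<^sup>2) + (\<Sum>j<n. c j * (b j z)\<^sup>2)"
          unfolding sum.distrib[symmetric] using elim
          by (intro sum.cong) (auto simp: cmod_power2 algebra_simps)
        then show ?thesis
          using True by (simp add: A_def B_def algebra_simps)
      next
        case False
        then have "a j z = 0 \<and> b j z = 0" if "j < n" for j
          using ab[OF that] unfolding L2_rep_def by blast
        then show ?thesis
          using False by (simp add: A_def B_def)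
      qed
    qed
  qed
  also have "\<dots> = integral\<^sup>L lborel (\<lambda>z. A z + B z)"
    using AB by (intro integral_completion) auto
  also have "\<dots> = integral\<^sup>L lborel A + integral\<^sup>L lborel B"
    using AB by simp
  finally show ?thesis
    by (simp add: A_def B_def)
qed

section \<open>The level domains and the assembly of the estimate\<close>

lemma open_Qsub: "open (Qsub T L x0 t0 \<beta> \<delta>)"
proof -
  have "Qsub T L x0 t0 \<beta> \<delta> = Q T L \<inter> {z. \<delta> < \<psi> x0 t0 \<beta> z}"
    by (auto simp: Qsub_def)
  moreover have "open {z. \<delta> < \<psi> x0 t0 \<beta> z}"
    unfolding \<psi>_def case_prod_beta' by (intro open_Collect_less continuous_intros)
  ultimately show ?thesis
    by (auto simp: Q_def open_Times)
qed

lemma bounded_Qsub: "bounded (Qsub T L x0 t0 \<beta> \<delta>)"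
  by (rule bounded_subset[of "{0..T} \<times> {0..L}"]) (auto simp: Qsub_def Q_def intro!: bounded_Times)

lemma has_weak_pd_weak_pd: "weak_pd_in_L2 U i j v \<Longrightarrow> has_weak_pd U i j v (weak_pd U i j v)"
  using someI_ex[of "has_weak_pd U i j v"] unfolding weak_pd_in_L2_def weak_pd_def by blast

theorem theorem1p1:
  fixes T L \<gamma> x0 t0 \<beta> \<epsilon> c :: real
  assumes "T > 0" and "L > 0"
    and "x0 > L" and "(x0 - L)\<^sup>2 < 1 / 3 * x0\<^sup>2"
    and "t0 \<in> {0<..<T}" and "\<beta> > 0"
    and "(x0 - L)\<^sup>2 < \<epsilon>" and "\<epsilon> < x0\<^sup>2"
    and "c \<in> {0<..<\<epsilon>}"
  defines "Qd \<equiv> Qsub T L x0 t0 \<beta>"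
  defines "w \<equiv> \<psi> x0 t0 \<beta>"
  shows "\<exists>\<Lambda>0 > 0. \<exists>C > 0. \<forall>\<Lambda> > \<Lambda>0. \<forall>v \<in> H14 (Qd c). supp (Qd c) v \<subseteq> Qd \<epsilon> \<longrightarrow>
    (LINT z:Qd c|lebesgue. exp (2 * \<Lambda> * w z) *
        (\<Lambda> ^ 7 * (cmod (v z))\<^sup>2
         + \<Lambda> ^ 5 * (cmod (weak_pd (Qd c) 0 1 v z))\<^sup>2
         + \<Lambda> ^ 3 * (cmod (weak_pd (Qd c) 0 2 v z))\<^sup>2
         + \<Lambda> * (cmod (weak_pd (Qd c) 0 3 v z))\<^sup>2))
    \<le> C * (LINT z:Qd c|lebesgue. exp (2 * \<Lambda> * w z) *
        (cmod (of_real \<gamma> * weak_pd (Qd c) 1 0 v z + weak_pd (Qd c) 0 4 v z))\<^sup>2)"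
proof -
  define U where "U = Qd c"
  \<comment> \<open>The three bounds required by the coercivity argument: the second absorbs a
    lower-order term into the weight, the third dominates the contribution of the time
    derivative.\<close>
  define \<Lambda>0 where "\<Lambda>0 = max 1 (max (1 / (x0 - L)\<^sup>2) (\<beta> * \<gamma>\<^sup>2))"
  have U: "open U" "bounded U"
    by (simp_all add: U_def Qd_def open_Qsub bounded_Qsub)
  have UL: "U \<subseteq> {z. 0 \<le> snd z \<and> snd z \<le> L}"
    by (auto simp: U_def Qd_def Qsub_def Q_def)
  have \<epsilon>U: "Qd \<epsilon> \<subseteq> U"
    using assms by (auto simp: U_def Qd_def Qsub_def)
  have main: "(LINT z:U|lebesgue. exp (2 * \<Lambda> * w z) *
        (\<Lambda> ^ 7 * (cmod (v z))\<^sup>2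
         + \<Lambda> ^ 5 * (cmod (weak_pd U 0 1 v z))\<^sup>2
         + \<Lambda> ^ 3 * (cmod (weak_pd U 0 2 v z))\<^sup>2
         + \<Lambda> * (cmod (weak_pd U 0 3 v z))\<^sup>2))
    \<le> carleman_const x0 L * (LINT z:U|lebesgue. exp (2 * \<Lambda> * w z) *
        (cmod (of_real \<gamma> * weak_pd U 1 0 v z + weak_pd U 0 4 v z))\<^sup>2)"
    if \<Lambda>: "\<Lambda> > \<Lambda>0" and v: "v \<in> H14 U" and supp: "supp U v \<subseteq> Qd \<epsilon>" for \<Lambda> v
  proof -
    define K where "K = supp U v"
    \<comment> \<open>The support is closed by construction, and bounded because it lies in
      \<open>U\<close>.\<close>
    have K: "compact K" "K \<subseteq> U"
      using supp \<epsilon>U bounded_subset[OF U(2)] closed_supp[of U v]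
      by (auto simp: K_def compact_eq_bounded_closed)
    define g where "g = (\<lambda>j. if j = 0 then v else weak_pd U 0 j v)"
    have wx: "weak_pd_in_L2 U 0 j v" if "j \<in> {1..4}" for j
      using v that by (auto simp: H14_def)
    have wt: "weak_pd_in_L2 U 1 0 v" and v2: "v \<in> L2 U"
      using v by (auto simp: H14_def)
    have "g j \<in> L2 U" if "j \<le> 4" for j
      using v2 wx[of j] that by (auto simp: g_def weak_pd_in_L2_def)
    then have "\<exists>a b. complex_parts_on U (g j) a b" if "j \<le> 4" for j
      using complex_parts_on_exists[OF U(1)] that by metis
    then obtain a' b' where ab': "\<And>j. j \<le> 4 \<Longrightarrow> complex_parts_on U (g j) (a' j) (b' j)"
      by metis
    \<comment> \<open>Only the representatives of order zero are cut off to \<open>K\<close>; the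
      derivatives keep theirs.\<close>
    define a where "a = (\<lambda>j. if j = 0 then (\<lambda>z. indicator K z * a' 0 z) else a' j)"
    define b where "b = (\<lambda>j. if j = 0 then (\<lambda>z. indicator K z * b' 0 z) else b' j)"
    have ab: "complex_parts_on U (g j) (a j) (b j)" if "j \<le> 4" for j
    proof (cases "j = 0")
      case True
      have "AE z in lebesgue. z \<in> U - K \<longrightarrow> g 0 z = 0"
        using AE_zero_outside_supp[of U v] by (simp add: K_def g_def)
      from complex_parts_on_cutoff[OF ab'[of 0] K(1) this] True show ?thesis
        by (simp add: a_def b_def)
    qed (use ab'[OF that] in \<open>simp add: a_def b_def\<close>)
    obtain a1 b1 where abt: "complex_parts_on U (weak_pd U 1 0 v) a1 b1"
      using complex_parts_on_exists[OF U(1)] wt by (auto simp: weak_pd_in_L2_def)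
    have weak: "weak_on U 0 j (a 0) (a j)" "weak_on U 0 j (b 0) (b j)" if "j \<in> {1..4}" for j
      using weak_on_parts[OF U _ ab[of 0] ab[of j]] has_weak_pd_weak_pd[OF wx[OF that]] that
      by (auto simp: g_def)
    have weakt: "weak_on U 1 0 (a 0) a1" "weak_on U 1 0 (b 0) b1"
      using weak_on_parts[OF U _ ab[of 0] abt] has_weak_pd_weak_pd[OF wt] by (auto simp: g_def)
    have "\<Lambda> * (x0 - L)\<^sup>2 \<ge> 1 / (x0 - L)\<^sup>2 * (x0 - L)\<^sup>2"
      using \<Lambda> by (intro mult_right_mono) (auto simp: \<Lambda>0_def)
    then have \<Lambda>': "\<Lambda> \<ge> 1" "\<Lambda> * (x0 - L)\<^sup>2 \<ge> 1" "\<Lambda> \<ge> \<beta> * \<gamma>\<^sup>2"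
      using \<Lambda> assms by (auto simp: \<Lambda>0_def)
    \<comment> \<open>The operator has real coefficients, so the estimate can be applied to the real
      and the imaginary part separately and then added.\<close>
    interpret a: compactly_supported_derivatives U K a a1 L x0 t0 \<beta> \<gamma> \<Lambda>
      by unfold_locales (use U UL K ab abt weak weakt assms \<Lambda>' in \<open>auto simp: a_def complex_parts_on_def\<close>)
    interpret b: compactly_supported_derivatives U K b b1 L x0 t0 \<beta> \<gamma> \<Lambda>
      by unfold_locales (use U UL K ab abt weak weakt assms \<Lambda>' in \<open>auto simp: b_def complex_parts_on_def\<close>)
    have W: "a.W = (\<lambda>z. exp (2 * \<Lambda> * w z))" "b.W = (\<lambda>z. exp (2 * \<Lambda> * w z))"
      by (auto simp: a.W_def b.W_def w_def fun_eq_iff)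
    have Wc: "continuous_on UNIV (\<lambda>z. exp (2 * \<Lambda> * w z))"
      using a.W_cont by (simp add: W)
    \<comment> \<open>The exponents are 7, 5, 3, 1 for \<open>j\<close> from 0 to 3; the subtraction
      does not truncate in this range.\<close>
    define p where "p = (\<lambda>j. \<Lambda> ^ (7 - 2 * j))"
    have sum4: "(\<Sum>j<4. p j * F j) = \<Lambda> ^ 7 * F 0 + \<Lambda> ^ 5 * F 1 + \<Lambda> ^ 3 * F 2 + \<Lambda> * F 3" for F :: "nat \<Rightarrow> real"
      by (simp add: p_def eval_nat_numeral)
    have lhs: "(LINT z:U|lebesgue. exp (2 * \<Lambda> * w z) * (\<Sum>j<4. p j * (cmod (g j z))\<^sup>2))
       = (\<integral>z. a.W z * (\<Sum>j<4. p j * (a j z)\<^sup>2) \<partial>lborel) + (\<integral>z. b.W z * (\<Sum>j<4. p j * (b j z)\<^sup>2) \<partial>lborel)"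
      unfolding W by (rule set_lebesgue_integral_weighted_squares[OF U Wc ab]) simp
    have rhs: "(LINT z:U|lebesgue. exp (2 * \<Lambda> * w z) *
        (cmod (of_real \<gamma> * weak_pd U 1 0 v z + weak_pd U 0 4 v z))\<^sup>2)
       = (\<integral>z. a.W z * (a.fP z)\<^sup>2 \<partial>lborel) + (\<integral>z. b.W z * (b.fP z)\<^sup>2 \<partial>lborel)"
      using set_lebesgue_integral_weighted_squares[OF U Wc, of 1
          "\<lambda>_ z. of_real \<gamma> * weak_pd U 1 0 v z + weak_pd U 0 4 v z" "\<lambda>_. a.fP" "\<lambda>_. b.fP" "\<lambda>_. 1"]
        complex_parts_on_lin[OF abt ab[of 4], of \<gamma>]
      by (simp add: W a.fP_def b.fP_def g_def)
    have "(LINT z:U|lebesgue. exp (2 * \<Lambda> * w z) * (\<Sum>j<4. p j * (cmod (g j z))\<^sup>2))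
       \<le> carleman_const x0 L * (\<integral>z. a.W z * (a.fP z)\<^sup>2 \<partial>lborel)
         + carleman_const x0 L * (\<integral>z. b.W z * (b.fP z)\<^sup>2 \<partial>lborel)"
      unfolding lhs unfolding sum4 by (rule add_mono[OF a.estimate b.estimate])
    then show ?thesis
      unfolding rhs distrib_left[of "carleman_const x0 L"] sum4 by (simp add: g_def)
  qed
  show ?thesis
    using main carleman_const_pos[OF assms(3)] unfolding U_def
    by (intro exI[of _ \<Lambda>0] exI[of _ "carleman_const x0 L"] conjI) (auto simp: \<Lambda>0_def)
qed

end
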